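(* Let $(A,\Theta)$ be a complex principally polarised abelian variety, $A=\mathbb{C}^n/(\mathbb{Z}^n+\tau\mathbb{Z}^n)$ with $\tau\in\mathbb{H}_n$ and $\Theta=\mathrm{div}\,\theta$. On the smooth locus $\Theta^s$ of $\Theta$, the zero locus of $\eta$ is precisely the ramification locus of the Gauss map $$\Gamma:\Theta^s\longrightarrow\mathbb{P}(T_0A)^*$$ sending a point of $\Theta^s$ to its tangent space, translated to a subspace of $T_0A$.
   Context: $\mathbb{H}_n$ is the Siegel upper half space of degree $n$; vectors are column vectors and ${}^t$ denotes transpose. For fixed $\tau\in\mathbb{H}_n$ the Riemann theta function is $\theta(z)=\theta(z,\tau)=\sum_{m\in\mathbb{Z}^n}e^{\pi i\,{}^tm\tau m+2\pi i\,{}^tmz}$, $z\in\mathbb{C}^n$. By its quasi-periodicity $\Theta=\mathrm{div}\,\theta$ is a well-defined divisor on $A=\mathbb{C}^n/(\mathbb{Z}^n+\tau\mathbb{Z}^n)$. Write $\theta_i=\partial\theta/\partial z_i$, $\theta_{ij}=\partial^2\theta/\partial z_i\partial z_j$. For a square matrix $(h_{ij})$, $(h_{ij})^c$ denotes its cofactor matrix with entries $h^c_{ij}=(-1)^{i+j}\det(h_{kl})_{k\ne i,l\ne j}$ (equal to $(1)$ for a $1\times 1$ matrix). Put $\eta={}^t(\theta_i)(\theta_{ij})^c(\theta_j)$, considered on the zero locus of $\theta$. It is a known property that for $\theta(z)=0$ and $u,v\in\mathbb{Z}^n$ one has $\eta(z+\tau u+v)=(e^{-\pi i\,{}^tu\tau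 u-2\pi i\,{}^tuz})^{n+1}\eta(z)$, so the zero locus of $\eta$ is well-defined as a subset of $\Theta$. $\mathbb{P}(T_0A)^*$ is the projective space of hyperplanes in $T_0A\cong\mathbb{C}^n$. The ramification locus of $\Gamma$ is the set of points $x\in\Theta^s$ at which the tangent map $d\Gamma:T_x\Theta\to T_{\Gamma(x)}\mathbb{P}(T_0A)^*$ (between spaces of dimension $n-1$) is not an isomorphism. *)

theory Defs
  imports "HOL-Analysis.Analysis" "Jordan_Normal_Form.Determinant"
begin

no_notation Matrix.vec_index (infixl "$" 100)

definition siegel_upper_half_space :: "(complex^'n^'n) set" where
  "siegel_upper_half_space =
     {\<tau>. transpose \<tau> = \<tau> \<and>
          (\<forall>x::real^'n. x \<noteq> 0 \<longrightarrow> x \<bullet> ((\<chi> i j. Im (\<tau> $ i $ j)) *v x) > 0)}"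

definition int_vec :: "int^'n \<Rightarrow> complex^'n" where
  "int_vec m = (\<chi> i. of_int (m $ i))"

definition riemann_theta :: "complex^'n^'n \<Rightarrow> complex^'n \<Rightarrow> complex" where
  "riemann_theta \<tau> z =
     (\<Sum>\<^sub>\<infinity>m::int^'n.
        exp (of_real pi * \<i> * (\<Sum>i\<in>UNIV. \<Sum>j\<in>UNIV. int_vec m $ i * \<tau> $ i $ j * int_vec m $ j)
             + 2 * of_real pi * \<i> * (\<Sum>i\<in>UNIV. int_vec m $ i * z $ i)))"

definition complex_partial :: "'n \<Rightarrow> (complex^'n \<Rightarrow> complex) \<Rightarrow> complex^'n \<Rightarrow> complex" where
  "complex_partial i f z = deriv (\<lambda>t. f (z + axis i t)) 0"

text \<open>The index type is enumerated in order to give the sign and the minor in the cofactor a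
  meaning. Renumbering permutes rows and columns simultaneously, so the cofactor matrix does not
  depend on the enumeration.\<close>

definition cofactor_matrix :: "complex^'n^'n \<Rightarrow> complex^'n^'n" where
  "cofactor_matrix h =
     (let e = from_nat_into (UNIV :: 'n set); r = to_nat_on (UNIV :: 'n set);
          H = Matrix.mat CARD('n) CARD('n) (\<lambda>(k, l). h $ e k $ e l)
      in \<chi> i j. Determinant.cofactor H (r i) (r j))"

definition eta :: "complex^'n^'n \<Rightarrow> complex^'n \<Rightarrow> complex" where
  "eta \<tau> z =
     (let g = (\<lambda>i. complex_partial i (riemann_theta \<tau>) z);
          h = (\<chi> i j. complex_partial i (complex_partial j (riemann_theta \<tau>)) z)
      in \<Sum>i\<in>UNIV. \<Sum>j\<in>UNIV. g i * cofactor_matrix h $ i $ j * g j)"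

definition lattice_rel :: "complex^'n^'n \<Rightarrow> ((complex^'n) \<times> (complex^'n)) set" where
  "lattice_rel \<tau> = {(z, w). \<exists>u v. w = z + \<tau> *v int_vec u + int_vec v}"

definition complex_torus :: "complex^'n^'n \<Rightarrow> (complex^'n) set set" where
  "complex_torus \<tau> = UNIV // lattice_rel \<tau>"

definition torus_point :: "complex^'n^'n \<Rightarrow> complex^'n \<Rightarrow> (complex^'n) set" where
  "torus_point \<tau> z = lattice_rel \<tau> `` {z}"

text \<open>The support of the divisor; its scheme structure, given locally by the equation
  \<open>riemann_theta \<tau> = 0\<close>, enters through the tangent spaces below.\<close>

definition theta_divisor :: "complex^'n^'n \<Rightarrow> (complex^'n) set set" where
  "theta_divisor \<tau> = {x \<in> complex_torus \<tau>. \<exists>z\<in>x. riemann_theta \<tau> z = 0}"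

text \<open>The tangent space of the divisor at \<open>x\<close>, that is, the kernel of the differential of the local
  equation at a point \<open>z\<close> over \<open>x\<close>. It lies in \<open>T\<^sub>x A\<close>, identified with \<open>\<complex>\<^sup>n\<close> by the
  differential of the quotient map at \<open>z\<close>. By quasi-periodicity the kernel is independent of the
  choice of \<open>z\<close> when \<open>x\<close> lies on the divisor.\<close>

definition theta_tangent :: "complex^'n^'n \<Rightarrow> (complex^'n) set \<Rightarrow> (complex^'n) set" where
  "theta_tangent \<tau> x = {v. frechet_derivative (riemann_theta \<tau>) (at (SOME z. z \<in> x)) v = 0}"

text \<open>Smooth points: the tangent space has the dimension of the divisor.\<close>

definition theta_smooth :: "complex^'n^'n \<Rightarrow> (complex^'n) set set" where
  "theta_smooth \<tau> = {x \<in> theta_divisor \<tau>. vec.dim (theta_tangent \<tau> x) = CARD('n) - 1}"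

text \<open>The translation by \<open>-x\<close> lifts to \<open>w \<mapsto> w - z\<close>, so under the identifications of \<open>T\<^sub>x A\<close> and
  \<open>T\<^sub>0 A\<close> with \<open>\<complex>\<^sup>n\<close> its differential \<open>T\<^sub>x A \<rightarrow> T\<^sub>0 A\<close> is the identity.\<close>

definition gauss_map :: "complex^'n^'n \<Rightarrow> (complex^'n) set \<Rightarrow> (complex^'n) set" where
  "gauss_map \<tau> x = theta_tangent \<tau> x"

text \<open>The projective space of hyperplanes and its standard affine charts, on the hyperplanes not
  containing the \<open>k\<close>-th basis vector. A hyperplane is sent to its equation normalised to have
  \<open>k\<close>-th coefficient 1, so a chart takes values in the affine space \<open>{a. a $ k = 1}\<close>, and its
  differential identifies the tangent spaces with \<open>{b. b $ k = 0}\<close>.\<close>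

definition dual_projective_space :: "(complex^'n) set set" where
  "dual_projective_space = {H. vec.subspace H \<and> vec.dim H = CARD('n) - 1}"

definition chart_domain :: "'n \<Rightarrow> (complex^'n) set set" where
  "chart_domain k = {H \<in> dual_projective_space. axis k 1 \<notin> H}"

definition hyperplane_chart :: "'n \<Rightarrow> (complex^'n) set \<Rightarrow> complex^'n" where
  "hyperplane_chart k H = (THE a. a $ k = 1 \<and> H = {v. (\<Sum>i\<in>UNIV. a $ i * v $ i) = 0})"

definition chart_tangent :: "'n \<Rightarrow> (complex^'n) set" where
  "chart_tangent k = {b. b $ k = 0}"

text \<open>The Gauss map in the chart \<open>k\<close>, lifted to \<open>\<complex>\<^sup>n\<close>, is differentiated within the preimage of
  the smooth locus. A derivative within a submanifold is determined only on the tangent space of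
  the submanifold; only its restriction to \<open>theta_tangent\<close> is used, and this is the tangent map.\<close>

definition gauss_differential ::
  "complex^'n^'n \<Rightarrow> 'n \<Rightarrow> complex^'n \<Rightarrow> complex^'n \<Rightarrow> complex^'n" where
  "gauss_differential \<tau> k z =
     frechet_derivative (\<lambda>w. hyperplane_chart k (gauss_map \<tau> (torus_point \<tau> w)))
       (at z within {w. torus_point \<tau> w \<in> theta_smooth \<tau>})"

text \<open>Whether the tangent map is an isomorphism depends neither on the point \<open>z\<close> over \<open>x\<close>
  nor on the chart \<open>k\<close> around the image of \<open>x\<close>.\<close>

definition gauss_ramification_locus :: "complex^'n^'n \<Rightarrow> (complex^'n) set set" where
  "gauss_ramification_locus \<tau> =
     {x \<in> theta_smooth \<tau>. \<exists>z\<in>x. \<exists>k. gauss_map \<tau> x \<in> chart_domain k \<and>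
        \<not> bij_betw (gauss_differential \<tau> k z) (theta_tangent \<tau> x) (chart_tangent k)}"

definition eta_zero_locus :: "complex^'n^'n \<Rightarrow> (complex^'n) set set" where
  "eta_zero_locus \<tau> = {x \<in> theta_divisor \<tau>. \<exists>z\<in>x. eta \<tau> z = 0}"

end

theory Submission
  imports Defs
begin

text \<open>Near a smooth point the Gauss map, in the chart \<open>k\<close>, is \<open>w \<mapsto> g(w) / g\<^sub>k(w)\<close>, where \<open>g\<close> is the gradient of
  \<open>\<theta>\<close>. Its differential \<open>v \<mapsto> (h v) / g\<^sub>k - (h v)\<^sub>k g / g\<^sub>k\<^sup>2\<close>, with \<open>h\<close> the Hessian, kills \<open>v\<close> iff \<open>h v\<close> is a multiple of
  \<open>g\<close>. Between spaces of dimension \<open>n - 1\<close> it is therefore not an isomorphism iff there is \<open>v \<noteq> 0\<close> with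
  \<open>g \<cdot> v = 0\<close> and \<open>h v = c g\<close>, that is, iff the matrix \<open>h\<close> bordered by \<open>g\<close> is singular; expanding its determinant
  along the border gives \<open>- \<eta>\<close>.\<close>

text \<open>The obstacle is that \<open>gauss_differential\<close> is whichever derivative
  \<open>frechet_derivative\<close> selects within the preimage of the smooth locus. This set has
  codimension one, so a derivative within it is not unique. The formula for the differential can be
  asserted only on tangent vectors, and only once each tangent direction is known to be approached
  by zeros of theta; a fixed point argument supplies these zeros. A second choice is hidden in
  \<open>theta_tangent\<close>, which uses an arbitrary representative of the point: at a zero, a
  shift by the lattice multiplies the gradient by a nonzero factor, so the kernel does not change.
  The derivatives of theta exist because its Fourier coefficients decay faster than any exponential,
  a property that survives differentiation term by term. The case n = 1 is included: both tangent
  spaces are zero, and at a smooth point eta is the square of a nonzero derivative.\<close>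

section \<open>Bordered determinants and hyperplanes\<close>

notation Matrix.vec_index (infixl "$v" 100)

text \<open>Laplace expansion is applied twice: along the border column, whose corner entry is 0,
  and then in each minor along the border row. A minor of \<open>H\<close> remains. Deleting row
  \<open>i\<close> moves the border row up from index \<open>n\<close> to \<open>m\<close>, so the
  exponents \<open>i + n\<close> and \<open>m + j\<close> add up to \<open>i + j\<close> plus an odd
  number; this is the minus sign.\<close>

lemma det_bordered:
  fixes H :: "'a::comm_ring_1 Matrix.mat" and g :: "nat \<Rightarrow> 'a"
  assumes H: "H \<in> carrier_mat n n" and n: "n \<ge> 1"
  shows "Determinant.det (Matrix.mat (Suc n) (Suc n)
           (\<lambda>(i, j). if i < n then (if j < n then H $$ (i, j) else g i) else if j < n then g j else 0))
         = - (\<Sum>i<n. \<Sum>j<n. g i * Determinant.cofactor H i j * g j)"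
    (is "Determinant.det ?B = _")
proof -
  obtain m where m: "n = Suc m" using n by (cases n) auto
  have cof: "Determinant.cofactor ?B i n = - (\<Sum>j<n. Determinant.cofactor H i j * g j)" if i: "i < n" for i
  proof -
    let ?M = "mat_delete ?B i n"
    have M: "?M \<in> carrier_mat n n"
      by (rule carrier_matI) simp_all
    have "Determinant.det ?M = (\<Sum>j<n. ?M $$ (m, j) * Determinant.cofactor ?M m j)"
      by (rule laplace_expansion_row[OF M, symmetric, THEN sym]) (simp add: m)
    also have "\<dots> = (\<Sum>j<n. g j * ((- 1) ^ (m + j) * Determinant.det (mat_delete H i j)))"
    proof (rule sum.cong[OF refl])
      fix j assume "j \<in> {..<n}"
      hence j: "j < n" by simp
      have a: "?M $$ (m, j) = g j"
        using i j by (simp add: mat_delete_def m)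
      have b: "mat_delete ?M m j = mat_delete H i j"
        by (rule eq_matI) (use H i j in \<open>auto simp: mat_delete_def m\<close>)
      show "?M $$ (m, j) * Determinant.cofactor ?M m j
          = g j * ((- 1) ^ (m + j) * Determinant.det (mat_delete H i j))"
        unfolding a Determinant.cofactor_def b ..
    qed
    finally have "Determinant.cofactor ?B i n
        = (\<Sum>j<n. (- 1) ^ (i + n) * (g j * ((- 1) ^ (m + j) * Determinant.det (mat_delete H i j))))"
      by (simp add: Determinant.cofactor_def sum_distrib_left)
    also have "\<dots> = (\<Sum>j<n. - (Determinant.cofactor H i j * g j))"
    proof (rule sum.cong[OF refl])
      fix j
      have sgn: "(- 1) ^ (i + n) * (- 1) ^ (m + j) = - ((- 1) ^ (i + j) :: 'a)"
      proof -
        have "(i + n) + (m + j) = (i + j) + 2 * m + 1" by (simp add: m)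
        hence "(- 1) ^ (i + n) * (- 1) ^ (m + j) = ((- 1) ^ ((i + j) + 2 * m + 1) :: 'a)"
          by (metis power_add)
        also have "\<dots> = - ((- 1) ^ (i + j))" by (simp add: power_add power_mult)
        finally show ?thesis .
      qed
      have "(- 1) ^ (i + n) * (g j * ((- 1) ^ (m + j) * Determinant.det (mat_delete H i j)))
          = ((- 1) ^ (i + n) * (- 1) ^ (m + j)) * (Determinant.det (mat_delete H i j) * g j)"
        by (simp only: ac_simps)
      also have "\<dots> = - (Determinant.cofactor H i j * g j)"
        unfolding sgn Determinant.cofactor_def by (simp add: mult.assoc)
      finally show "(- 1) ^ (i + n) * (g j * ((- 1) ^ (m + j) * Determinant.det (mat_delete H i j)))
          = - (Determinant.cofactor H i j * g j)" .
    qed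
    finally show ?thesis by (simp add: sum_negf)
  qed
  have "Determinant.det ?B = (\<Sum>i<Suc n. ?B $$ (i, n) * Determinant.cofactor ?B i n)"
    by (rule laplace_expansion_column) auto
  also have "\<dots> = (\<Sum>i<n. g i * Determinant.cofactor ?B i n)"
    by simp
  also have "\<dots> = (\<Sum>i<n. - (\<Sum>j<n. g i * Determinant.cofactor H i j * g j))"
    by (rule sum.cong[OF refl]) (simp add: cof sum_distrib_left mult.assoc)
  finally show ?thesis by (simp add: sum_negf)
qed

text \<open>A kernel vector of the transposed bordered matrix, with entries of \<open>v\<close> and
  border coordinate \<open>- c\<close>, is a solution of the right-hand side. Since
  \<open>g \<noteq> 0\<close>, a kernel vector with \<open>v = 0\<close> would also have
  \<open>c = 0\<close>. The transpose enters because the derivative of the \<open>j\<close>-th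
  partial in direction \<open>v\<close> sums over the first index of \<open>h\<close>.\<close>

lemma cofactor_form_eq_0_iff:
  fixes h :: "complex^'n^'n" and g :: "complex^'n"
  assumes g: "g \<noteq> 0"
  shows "(\<Sum>i\<in>UNIV. \<Sum>j\<in>UNIV. g $ i * cofactor_matrix h $ i $ j * g $ j) = 0 \<longleftrightarrow>
         (\<exists>v c. v \<noteq> 0 \<and> (\<Sum>i\<in>UNIV. g $ i * v $ i) = 0 \<and> (\<forall>j. (\<Sum>i\<in>UNIV. h $ i $ j * v $ i) = c * g $ j))"
proof -
  define n where "n = CARD('n)"
  define e where "e = from_nat_into (UNIV :: 'n set)"
  define r where "r = to_nat_on (UNIV :: 'n set)"
  define H where "H = Matrix.mat n n (\<lambda>(k, l). h $ e k $ e l)"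
  define G where "G = (\<lambda>i. g $ e i)"
  define B where "B = Matrix.mat (Suc n) (Suc n)
           (\<lambda>(i, j). if i < n then (if j < n then H $$ (i, j) else G i) else if j < n then G j else 0)"
  have er [simp]: "e (r i) = i" for i by (simp add: e_def r_def)
  have bij: "bij_betw r UNIV {..<n}" unfolding r_def n_def by (rule to_nat_on_finite) simp
  have rn [simp]: "r i < n" for i using bij by (auto simp: bij_betw_def)
  have re [simp]: "r (e k) = k" if "k < n" for k
  proof -
    have "k \<in> range r" using bij that by (simp add: bij_betw_def)
    thus ?thesis by auto
  qed
  have n1: "n \<ge> 1" unfolding n_def by (simp add: Suc_leI)
  have reidx: "(\<Sum>k<n. f k) = (\<Sum>i\<in>UNIV. f (r i))" for f :: "nat \<Rightarrow> complex"
    by (rule sum.reindex_bij_betw[OF bij, symmetric])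
  have Hc: "H \<in> carrier_mat n n" by (simp add: H_def)
  have Bc: "B \<in> carrier_mat (Suc n) (Suc n)" by (simp add: B_def)
  have BTc: "transpose_mat B \<in> carrier_mat (Suc n) (Suc n)" using Bc by simp
  have "(\<Sum>i\<in>UNIV. \<Sum>j\<in>UNIV. g $ i * cofactor_matrix h $ i $ j * g $ j)
      = (\<Sum>i<n. \<Sum>j<n. G i * Determinant.cofactor H i j * G j)"
    unfolding cofactor_matrix_def Let_def e_def[symmetric] r_def[symmetric] n_def[symmetric]
      H_def[symmetric] by (simp add: reidx G_def)
  also have "\<dots> = - Determinant.det B"
    using det_bordered[OF Hc n1, of G] by (simp add: B_def)
  also have "\<dots> = - Determinant.det (transpose_mat B)"
    using det_transpose[OF Bc] by simp
  finally have "(\<Sum>i\<in>UNIV. \<Sum>j\<in>UNIV. g $ i * cofactor_matrix h $ i $ j * g $ j) = 0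
      \<longleftrightarrow> Determinant.det (transpose_mat B) = 0" by simp
  also have "\<dots> \<longleftrightarrow> (\<exists>x. x \<in> carrier_vec (Suc n) \<and> x \<noteq> 0\<^sub>v (Suc n) \<and> transpose_mat B *\<^sub>v x = 0\<^sub>v (Suc n))"
    by (rule det_0_iff_vec_prod_zero[OF BTc])
  also have "\<dots> \<longleftrightarrow> (\<exists>v c. v \<noteq> 0 \<and> (\<Sum>i\<in>UNIV. g $ i * v $ i) = 0 \<and>
        (\<forall>j. (\<Sum>i\<in>UNIV. h $ i $ j * v $ i) = c * g $ j))" (is "?L = ?R")
  proof -
    have prod: "(transpose_mat B *\<^sub>v x) $v k =
        (if k < n then (\<Sum>i\<in>UNIV. h $ i $ e k * (x $v r i)) + g $ e k * (x $v n)
         else (\<Sum>i\<in>UNIV. g $ i * (x $v r i)))"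
      if "k < Suc n" "x \<in> carrier_vec (Suc n)" for x k
      using that
      by (auto simp: B_def H_def G_def scalar_prod_def atLeast0LessThan reidx)
    show ?thesis
    proof
      assume ?L
      then obtain x where x: "x \<in> carrier_vec (Suc n)" "x \<noteq> 0\<^sub>v (Suc n)"
        and x0: "transpose_mat B *\<^sub>v x = 0\<^sub>v (Suc n)" by blast
      define v where "v = (\<chi> i. x $v r i)"
      have 1: "(\<Sum>i\<in>UNIV. g $ i * v $ i) = 0"
        using prod[of n x] x x0 by (simp add: v_def)
      have 2: "(\<Sum>i\<in>UNIV. h $ i $ j * v $ i) = - (x $v n) * g $ j" for j
        using prod[of "r j" x] x x0 rn[of j]
        by (simp add: v_def less_SucI eq_neg_iff_add_eq_0 mult.commute)
      have "v \<noteq> 0"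
      proof
        assume v0: "v = 0"
        obtain k where "g $ k \<noteq> 0" using g by (metis Finite_Cartesian_Product.vec_eq_iff Finite_Cartesian_Product.zero_index)
        with 2[of k] v0 have xn: "x $v n = 0" by simp
        have "x $v k = 0" if "k < n" for k
          using v0 that re[OF that] unfolding v_def by (metis vec_lambda_beta Finite_Cartesian_Product.zero_index)
        with xn have "x = 0\<^sub>v (Suc n)"
          by (intro eq_vecI) (use x in \<open>auto simp: less_Suc_eq\<close>)
        with x show False by simp
      qed
      with 1 2 show ?R by blast
    next
      assume ?R
      then obtain v c where v: "v \<noteq> 0" "(\<Sum>i\<in>UNIV. g $ i * v $ i) = 0"
        "\<And>j. (\<Sum>i\<in>UNIV. h $ i $ j * v $ i) = c * g $ j" by blast
      define x where "x = Matrix.vec (Suc n) (\<lambda>k. if k < n then v $ e k else - c)"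
      have xc: "x \<in> carrier_vec (Suc n)" by (simp add: x_def)
      have xr: "x $v r i = v $ i" for i by (simp add: x_def less_SucI)
      have xn: "x $v n = - c" by (simp add: x_def)
      obtain k where k: "v $ k \<noteq> 0" using v(1) by (metis Finite_Cartesian_Product.vec_eq_iff Finite_Cartesian_Product.zero_index)
      have "x \<noteq> 0\<^sub>v (Suc n)"
      proof
        assume "x = 0\<^sub>v (Suc n)"
        hence "x $v r k = 0" by (simp add: less_SucI)
        with xr k show False by simp
      qed
      moreover have "transpose_mat B *\<^sub>v x = 0\<^sub>v (Suc n)"
        by (rule eq_vecI) (use BTc v in \<open>auto simp: prod[OF _ xc] xr xn simp del: index_mult_mat_vec\<close>)
      ultimately show ?L using xc by blast
    qed
  qed
  finally show ?thesis .
qed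

section \<open>Hyperplanes and their affine charts\<close>

lemma sum_mult_axis:
  fixes b :: "complex^'n"
  shows "(\<Sum>i\<in>UNIV. b $ i * axis k c $ i) = b $ k * c"
  by (simp add: axis_def if_distrib cong: if_cong)

lemma norm_axis: "norm (axis i x :: 'a::real_normed_vector^'n) = norm x"
proof -
  have "norm (axis i x $ j) ^ 2 = (if j = i then norm x ^ 2 else 0)" for j by (simp add: axis_def)
  thus ?thesis by (simp add: norm_vec_def L2_set_def)
qed

lemma bounded_linear_axis: "bounded_linear (axis i :: 'a::real_normed_vector \<Rightarrow> 'a^'n)"
proof (rule bounded_linear_intro[where K = 1])
  show "norm (axis i x :: 'a^'n) \<le> norm x * 1" for x :: 'a by (simp add: norm_axis)
qed (simp_all add: Finite_Cartesian_Product.vec_eq_iff axis_def)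

lemma subspace_hyperplane:
  fixes g :: "complex^'n"
  shows "vec.subspace {v. (\<Sum>i\<in>UNIV. g $ i * v $ i) = 0}"
  by (rule vec.subspaceI) (auto simp: distrib_left sum.distrib mult.left_commute simp flip: sum_distrib_left)

lemma dim_hyperplane:
  fixes g :: "complex^'n"
  assumes "g \<noteq> 0"
  shows "vec.dim {v. (\<Sum>i\<in>UNIV. g $ i * v $ i) = 0} = CARD('n) - 1" (is "vec.dim ?T = _")
proof -
  obtain k where k: "g $ k \<noteq> 0" using assms by (metis Finite_Cartesian_Product.vec_eq_iff Finite_Cartesian_Product.zero_index)
  have sub: "vec.subspace ?T" by (rule subspace_hyperplane)
  have ek: "(\<Sum>i\<in>UNIV. g $ i * axis k (1::complex) $ i) = g $ k"
    by (simp add: sum_mult_axis)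
  have "axis k 1 \<notin> ?T" using ek k by simp
  moreover have "vec.span ?T = ?T" using sub by (simp add: vec.span_eq_iff)
  ultimately have "vec.span ?T \<subset> vec.span (UNIV :: (complex^'n) set)"
    by (metis UNIV_I psubsetI subset_UNIV vec.span_UNIV)
  hence "vec.dim ?T < vec.dim (UNIV :: (complex^'n) set)"
    by (rule vec.dim_psubset)
  moreover have "vec.span (insert (axis k 1) ?T) = UNIV"
  proof (intro equalityI subsetI UNIV_I)
    fix v :: "complex^'n"
    \<comment> \<open>Subtracting this multiple of the basis vector moves \<open>v\<close> into the
      hyperplane, so one extra vector spans the whole space.\<close>
    define c where "c = (\<Sum>i\<in>UNIV. g $ i * v $ i) / g $ k"
    have "c * g $ k = (\<Sum>i\<in>UNIV. g $ i * v $ i)" using k by (simp add: c_def)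
    hence "v - c *s axis k 1 \<in> ?T"
      using ek by (simp add: right_diff_distrib sum_subtractf mult.left_commute flip: sum_distrib_left)
    thus "v \<in> vec.span (insert (axis k 1) ?T)"
      unfolding vec.span_insert by (intro CollectI exI[of _ c]) (rule vec.span_base)
  qed
  hence "vec.dim (UNIV :: (complex^'n) set) \<le> vec.dim ?T + 1"
    using vec.dim_insert[of "axis k 1" ?T] vec.dim_span[of "insert (axis k 1) ?T"] by (auto split: if_splits)
  moreover have "vec.dim (UNIV :: (complex^'n) set) = CARD('n)"
    by (rule vec_dim_card)
  ultimately show ?thesis by linarith
qed

text \<open>Uniqueness holds because the vectors e_i - (g_i / g_k) e_k lie in the hyperplane;
  inserting them into another equation \<open>a\<close> with \<open>a $ k = 1\<close> forces a_i =
  g_i / g_k.\<close>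

lemma hyperplane_chart_hyperplane:
  fixes g :: "complex^'n"
  assumes k: "g $ k \<noteq> 0"
  shows "hyperplane_chart k {v. (\<Sum>i\<in>UNIV. g $ i * v $ i) = 0} = (\<chi> i. g $ i / g $ k)"
  unfolding hyperplane_chart_def
proof (rule the_equality)
  have "(\<Sum>i\<in>UNIV. g $ i / g $ k * v $ i) = (\<Sum>i\<in>UNIV. g $ i * v $ i) / g $ k" for v :: "complex^'n"
    by (simp add: sum_divide_distrib)
  thus "(\<chi> i. g $ i / g $ k) $ k = 1 \<and> {v. (\<Sum>i\<in>UNIV. g $ i * v $ i) = 0} =
      {v. (\<Sum>i\<in>UNIV. (\<chi> i. g $ i / g $ k) $ i * v $ i) = 0}"
    using k by simp
next
  fix a assume a: "a $ k = 1 \<and> {v. (\<Sum>i\<in>UNIV. g $ i * v $ i) = 0} = {v. (\<Sum>i\<in>UNIV. a $ i * v $ i) = 0}"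
  have s: "(\<Sum>j\<in>UNIV. b $ j * (axis i 1 - c *s axis k 1) $ j) = b $ i - c * b $ k" for b :: "complex^'n" and c i
    using sum_mult_axis[of b i 1] sum_mult_axis[of b k 1]
    by (simp add: right_diff_distrib sum_subtractf mult.left_commute flip: sum_distrib_left)
  have "a $ i = g $ i / g $ k" for i
  proof -
    have "axis i 1 - (g $ i / g $ k) *s axis k 1 \<in> {v. (\<Sum>i\<in>UNIV. g $ i * v $ i) = 0}"
      using s[of g i "g $ i / g $ k"] k by (simp del: vector_minus_component)
    hence "axis i 1 - (g $ i / g $ k) *s axis k 1 \<in> {v. (\<Sum>i\<in>UNIV. a $ i * v $ i) = 0}"
      using a by simp
    hence "a $ i - g $ i / g $ k * a $ k = 0"
      using s[of a i "g $ i / g $ k"] by (simp del: vector_minus_component)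
    thus ?thesis using a by simp
  qed
  thus "a = (\<chi> i. g $ i / g $ k)" by (simp add: Finite_Cartesian_Product.vec_eq_iff)
qed

text \<open>The linear map \<open>L\<close> below is the differential of \<open>w \<mapsto> G w / G w $ k\<close> at a point with \<open>G = g\<close> and
  \<open>dG = h\<^sup>t\<close>.\<close>

lemma bij_betw_hyperplane_iff:
  fixes h :: "complex^'n^'n" and g :: "complex^'n"
  assumes k: "g $ k \<noteq> 0"
  defines "T \<equiv> {v. (\<Sum>i\<in>UNIV. g $ i * v $ i) = 0}"
  defines "P \<equiv> \<lambda>v. (\<chi> j. \<Sum>i\<in>UNIV. h $ i $ j * v $ i)"
  defines "L \<equiv> \<lambda>v. \<chi> j. (P v $ j * g $ k - g $ j * P v $ k) / (g $ k * g $ k)"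
  shows "\<not> bij_betw L T (chart_tangent k) \<longleftrightarrow>
     (\<Sum>i\<in>UNIV. \<Sum>j\<in>UNIV. g $ i * cofactor_matrix h $ i $ j * g $ j) = 0"
proof -
  have g: "g \<noteq> 0" using k by auto
  have Padd: "P (x + y) $ j = P x $ j + P y $ j" for x y j
    by (simp add: P_def distrib_left sum.distrib)
  have Pscale: "P (c *s x) $ j = c * P x $ j" for c x j
    by (simp add: P_def sum_distrib_left mult.left_commute)
  have lin: "Vector_Spaces.linear (*s) (*s) L"
    unfolding Vector_Spaces.linear_iff
  proof (intro conjI allI vec.vector_space_axioms)
    show "L (x + y) = L x + L y" for x y
      unfolding Finite_Cartesian_Product.vec_eq_iff
      by (simp add: L_def Padd flip: add_divide_distrib) (simp add: algebra_simps)
    show "L (c *s x) = c *s L x" for c x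
      unfolding Finite_Cartesian_Product.vec_eq_iff
      by (simp add: L_def Pscale) (simp add: algebra_simps)
  qed
  \<comment> \<open>Written as the hyperplane with equation \<open>axis k 1\<close>,
    \<open>chart_tangent k\<close> has the same dimension as \<open>T\<close>, so injectivity of
    \<open>L\<close> on \<open>T\<close> is the only question.\<close>
  have "(\<Sum>i\<in>UNIV. axis k (1::complex) $ i * b $ i) = b $ k" for b
    using sum_mult_axis[of b k 1] by (simp only: mult.commute mult_1_left)
  hence ct: "chart_tangent k = {b. (\<Sum>i\<in>UNIV. axis k (1::complex) $ i * b $ i) = 0}"
    by (simp only: chart_tangent_def)
  \<comment> \<open>Rescaling the gradient does not move the hyperplane, so a change of the gradient
    along \<open>g\<close> is invisible in the chart; nothing else is lost.\<close>
  have L0: "L v = 0 \<longleftrightarrow> (\<exists>c. \<forall>j. P v $ j = c * g $ j)" for v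
  proof
    assume "L v = 0"
    hence "L v $ j = 0" for j by simp
    hence "(P v $ j * g $ k - g $ j * P v $ k) / (g $ k * g $ k) = 0" for j
      by (simp only: L_def vec_lambda_beta)
    hence "P v $ j = P v $ k / g $ k * g $ j" for j using k by (simp add: field_simps)
    thus "\<exists>c. \<forall>j. P v $ j = c * g $ j" by blast
  next
    assume "\<exists>c. \<forall>j. P v $ j = c * g $ j"
    then obtain c where "\<And>j. P v $ j = c * g $ j" by blast
    thus "L v = 0" unfolding L_def by (simp add: Finite_Cartesian_Product.vec_eq_iff)
  qed
  have inj: "inj_on L T \<longleftrightarrow> (\<forall>v\<in>T. L v = 0 \<longrightarrow> v = 0)"
    by (rule vec.linear_inj_on_iff_eq_0[OF lin]) (simp add: T_def subspace_hyperplane)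
  have "L ` T = chart_tangent k" if "inj_on L T"
  proof (rule vec.subspace_dim_equal)
    show "vec.subspace (L ` T)" "vec.subspace (chart_tangent k)"
      using vec.linear_subspace_image[OF lin] subspace_hyperplane[of g] subspace_hyperplane[of "axis k 1"]
      by (simp_all add: T_def ct)
    show "L ` T \<subseteq> chart_tangent k" by (auto simp: L_def chart_tangent_def)
    have "vec.dim (L ` T) = vec.dim T"
      by (rule vec.dim_image_eq[OF lin]) (use that subspace_hyperplane[of g] in \<open>simp add: T_def vec.span_eq_iff[THEN iffD2]\<close>)
    thus "vec.dim (chart_tangent k) \<le> vec.dim (L ` T)"
      using dim_hyperplane[of g] dim_hyperplane[of "axis k (1::complex)"] g by (simp add: T_def ct axis_eq_0_iff)
  qed
  hence "\<not> bij_betw L T (chart_tangent k) \<longleftrightarrow> \<not> (\<forall>v\<in>T. L v = 0 \<longrightarrow> v = 0)"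
    using inj by (auto simp: bij_betw_def)
  also have "\<dots> \<longleftrightarrow> (\<exists>v c. v \<noteq> 0 \<and> (\<Sum>i\<in>UNIV. g $ i * v $ i) = 0 \<and> (\<forall>j. (\<Sum>i\<in>UNIV. h $ i $ j * v $ i) = c * g $ j))"
    unfolding L0 by (auto simp: T_def P_def)
  also have "\<dots> \<longleftrightarrow> (\<Sum>i\<in>UNIV. \<Sum>j\<in>UNIV. g $ i * cofactor_matrix h $ i $ j * g $ j) = 0"
    by (rule cofactor_form_eq_0_iff[OF g, symmetric])
  finally show ?thesis .
qed

section \<open>Fourier series with rapidly decaying coefficients\<close>

text \<open>A finite set of vectors lies in the box over the set \<open>P\<close> of all its
  entries. Over a box the sum of products factors into one-dimensional sums, each at most the full
  sum of \<open>f\<close>.\<close>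

lemma summable_on_prod_vec_nth:
  fixes f :: "'a \<Rightarrow> real"
  assumes nn: "\<And>k. f k \<ge> 0" and f: "f summable_on UNIV"
  shows "(\<lambda>m::'a^'n. \<Prod>i\<in>UNIV. f (m $ i)) summable_on UNIV"
proof (rule nonneg_bdd_above_summable_on)
  show "bdd_above (sum (\<lambda>m::'a^'n. \<Prod>i\<in>UNIV. f (m $ i)) ` {F. F \<subseteq> UNIV \<and> finite F})"
  proof (rule bdd_aboveI2)
    fix F :: "('a^'n) set" assume "F \<in> {F. F \<subseteq> UNIV \<and> finite F}"
    hence F: "finite F" by simp
    define P where "P = (\<Union>i. (\<lambda>m. m $ i) ` F)"
    have P: "finite P" using F by (simp add: P_def)
    have "(\<Sum>m\<in>F. \<Prod>i\<in>UNIV. f (m $ i)) = (\<Sum>g\<in>vec_nth ` F. \<Prod>i\<in>UNIV. f (g i))"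
      by (subst sum.reindex) (auto simp: inj_on_def vec_nth_inject)
    also have "\<dots> \<le> (\<Sum>g\<in>PiE (UNIV::'n set) (\<lambda>_. P). \<Prod>i\<in>UNIV. f (g i))"
      by (rule sum_mono2) (use P nn in \<open>auto simp: P_def finite_PiE intro!: prod_nonneg\<close>)
    also have "\<dots> = (\<Prod>i\<in>(UNIV::'n set). \<Sum>k\<in>P. f k)"
      by (rule prod_sum_PiE[symmetric]) (use P in auto)
    also have "\<dots> \<le> (\<Prod>i\<in>(UNIV::'n set). infsum f UNIV)"
      by (intro prod_mono conjI sum_nonneg nn finite_sum_le_infsum f P) auto
    finally show "(\<Sum>m\<in>F. \<Prod>i\<in>UNIV. f (m $ i)) \<le> (\<Prod>i\<in>(UNIV::'n set). infsum f UNIV)" .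
  qed
qed (simp add: prod_nonneg nn)

lemma summable_on_int_geometric: "(\<lambda>k::int. (1/2::real) ^ nat \<bar>k\<bar>) summable_on UNIV"
proof (rule nonneg_bdd_above_summable_on)
  \<comment> \<open>The closed form is 1 plus twice the geometric sum 1 - (1/2)^N over the positive
    side.\<close>
  have S: "(\<Sum>k\<in>{- int N..int N}. (1/2::real) ^ nat \<bar>k\<bar>) = 3 - 2 * (1/2) ^ N" for N
  proof (induction N)
    case (Suc N)
    have "{- int (Suc N)..int (Suc N)} = insert (- int (Suc N)) (insert (int (Suc N)) {- int N..int N})"
      by auto
    thus ?case by (simp add: Suc nat_add_distrib)
  qed simp
  show "bdd_above (sum (\<lambda>k::int. (1/2::real) ^ nat \<bar>k\<bar>) ` {F. F \<subseteq> UNIV \<and> finite F})"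
  proof (rule bdd_aboveI2)
    fix F :: "int set" assume "F \<in> {F. F \<subseteq> UNIV \<and> finite F}"
    hence F: "finite F" by simp
    define N where "N = nat (\<Sum>k\<in>F. \<bar>k\<bar>)"
    have "int N = (\<Sum>k\<in>F. \<bar>k\<bar>)" by (simp add: N_def sum_nonneg)
    have "\<bar>k\<bar> \<le> int N" if "k \<in> F" for k
      using member_le_sum[OF that, of abs] F \<open>int N = _\<close> by simp
    hence "F \<subseteq> {- int N..int N}" by (auto simp only: abs_le_iff atLeastAtMost_iff subset_iff neg_le_iff_le minus_le_iff)
    hence "(\<Sum>k\<in>F. (1/2::real) ^ nat \<bar>k\<bar>) \<le> (\<Sum>k\<in>{- int N..int N}. (1/2::real) ^ nat \<bar>k\<bar>)"
      by (intro sum_mono2) auto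
    also have "\<dots> \<le> 3" by (simp add: S)
    finally show "(\<Sum>k\<in>F. (1/2::real) ^ nat \<bar>k\<bar>) \<le> 3" .
  qed
qed simp

text \<open>The coefficients are arbitrary so that theta and all its iterated partial derivatives
  are instances: a partial derivative only multiplies them by
  \<open>2 * of_real pi * \<i> * int_vec m $ j\<close>.\<close>

definition exp_series :: "(int^'n \<Rightarrow> complex) \<Rightarrow> complex^'n \<Rightarrow> complex" where
  "exp_series c z = (\<Sum>\<^sub>\<infinity>m. c m * exp (2 * of_real pi * \<i> * (\<Sum>i\<in>UNIV. int_vec m $ i * z $ i)))"

text \<open>At \<open>z\<close> the exponential in the series is at most exp (2 pi norm z) to the
  power of the l1-norm of \<open>m\<close>. Allowing every \<open>R\<close> therefore gives absolute
  convergence at every complex \<open>z\<close>.\<close>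

definition rapid_decay :: "(int^'n \<Rightarrow> complex) \<Rightarrow> bool" where
  "rapid_decay c \<longleftrightarrow> (\<forall>R. (\<lambda>m. norm (c m) * exp (R * (\<Sum>i\<in>UNIV. \<bar>real_of_int (m $ i)\<bar>))) summable_on UNIV)"

definition deriv_coeff :: "'n \<Rightarrow> (int^'n \<Rightarrow> complex) \<Rightarrow> int^'n \<Rightarrow> complex" where
  "deriv_coeff j c m = 2 * of_real pi * \<i> * int_vec m $ j * c m"

lemma rapid_decayD:
  "rapid_decay c \<Longrightarrow> (\<lambda>m. norm (c m) * exp (R * (\<Sum>i\<in>UNIV. \<bar>real_of_int (m $ i)\<bar>))) summable_on UNIV"
  by (simp add: rapid_decay_def)

lemma summable_on_bounded:
  fixes f g :: "'a \<Rightarrow> real"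
  assumes "g summable_on UNIV" "\<And>x. f x \<le> g x" "\<And>x. 0 \<le> f x"
  shows "f summable_on UNIV"
  by (rule summable_on_comparison_test[OF assms(1)]) (use assms in auto)

text \<open>The new factor is absorbed by raising \<open>R\<close> to \<open>R + 1\<close>, since a
  coordinate is at most the l1-norm, which is at most its own exponential.\<close>

lemma rapid_decay_deriv_coeff:
  assumes "rapid_decay c"
  shows "rapid_decay (deriv_coeff j c)"
  unfolding rapid_decay_def
proof
  fix R :: real
  let ?l = "\<lambda>m::int^'a. (\<Sum>i\<in>UNIV. \<bar>real_of_int (m $ i)\<bar>)"
  have "(\<lambda>m. (2 * pi) * (norm (c m) * exp ((R + 1) * ?l m))) summable_on UNIV"
    by (intro summable_on_cmult_right rapid_decayD assms)
  moreover have "norm (deriv_coeff j c m) * exp (R * ?l m) \<le> (2 * pi) * (norm (c m) * exp ((R + 1) * ?l m))" for m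
  proof -
    have "\<bar>real_of_int (m $ j)\<bar> \<le> ?l m"
      by (rule member_le_sum) auto
    also have "\<dots> \<le> exp (?l m)" using exp_ge_add_one_self[of "?l m"] by linarith
    finally have "norm (c m) * (exp (R * ?l m) * \<bar>real_of_int (m $ j)\<bar>) \<le> norm (c m) * (exp (R * ?l m) * exp (?l m))"
      by (intro mult_left_mono) auto
    from mult_left_mono[OF this, of "2 * pi"] have "(2 * pi) * (norm (c m) * (exp (R * ?l m) * \<bar>real_of_int (m $ j)\<bar>))
        \<le> (2 * pi) * (norm (c m) * (exp (R * ?l m) * exp (?l m)))"
      by simp
    moreover have "norm (deriv_coeff j c m) = 2 * pi * \<bar>real_of_int (m $ j)\<bar> * norm (c m)"
      by (simp add: deriv_coeff_def norm_mult int_vec_def)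
    moreover have "exp ((R + 1) * ?l m) = exp (R * ?l m) * exp (?l m)"
      by (simp add: distrib_right exp_add)
    ultimately show ?thesis by (simp only: mult_ac)
  qed
  ultimately show "(\<lambda>m. norm (deriv_coeff j c m) * exp (R * ?l m)) summable_on UNIV"
    by (rule summable_on_bounded) auto
qed

lemma norm_int_vec_pairing_le:
  fixes z :: "complex^'n"
  shows "norm (2 * of_real pi * \<i> * (\<Sum>i\<in>UNIV. int_vec m $ i * z $ i))
         \<le> 2 * pi * (\<Sum>i\<in>UNIV. \<bar>real_of_int (m $ i)\<bar>) * norm z"
proof -
  have "norm (\<Sum>i\<in>UNIV. int_vec m $ i * z $ i) \<le> (\<Sum>i\<in>UNIV. \<bar>real_of_int (m $ i)\<bar> * norm z)"
    by (rule sum_norm_le) (auto simp: norm_mult int_vec_def Finite_Cartesian_Product.norm_nth_le intro!: mult_left_mono)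
  hence "2 * pi * norm (\<Sum>i\<in>UNIV. int_vec m $ i * z $ i) \<le> 2 * pi * ((\<Sum>i\<in>UNIV. \<bar>real_of_int (m $ i)\<bar>) * norm z)"
    by (intro mult_left_mono) (auto simp: sum_distrib_right)
  thus ?thesis by (simp add: norm_mult mult.assoc)
qed

lemma summable_on_exp_series:
  fixes c :: "int^'n \<Rightarrow> complex"
  assumes "rapid_decay c"
  shows "(\<lambda>m. c m * exp (2 * of_real pi * \<i> * (\<Sum>i\<in>UNIV. int_vec m $ i * z $ i))) summable_on UNIV"
proof (rule abs_summable_summable, rule summable_on_bounded)
  let ?l = "\<lambda>m::int^'n. (\<Sum>i\<in>UNIV. \<bar>real_of_int (m $ i)\<bar>)"
  show "(\<lambda>m. norm (c m) * exp ((2 * pi * norm z) * ?l m)) summable_on UNIV"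
    by (rule rapid_decayD[OF assms])
  show "norm (c m * exp (2 * of_real pi * \<i> * (\<Sum>i\<in>UNIV. int_vec m $ i * z $ i)))
        \<le> norm (c m) * exp ((2 * pi * norm z) * ?l m)" for m
  proof -
    have "norm (exp (2 * of_real pi * \<i> * (\<Sum>i\<in>UNIV. int_vec m $ i * z $ i)))
        \<le> exp (norm (2 * of_real pi * \<i> * (\<Sum>i\<in>UNIV. int_vec m $ i * z $ i)))"
      by (rule norm_exp)
    also have "\<dots> \<le> exp (2 * pi * ?l m * norm z)"
      using norm_int_vec_pairing_le[of m z] by simp
    finally have "norm (exp (2 * of_real pi * \<i> * (\<Sum>i\<in>UNIV. int_vec m $ i * z $ i)))
        \<le> exp ((2 * pi * norm z) * ?l m)"
      by (simp only: mult_ac)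
    thus ?thesis
      unfolding norm_mult by (intro mult_left_mono) auto
  qed
qed auto

text \<open>Factor out \<open>exp a\<close>; the second-order Taylor remainder of
  \<open>exp b\<close> is left.\<close>

lemma norm_exp_taylor_le:
  fixes a b :: complex
  shows "norm (exp (a + b) - exp a - b * exp a) \<le> exp (norm a) * (exp (norm b) * norm b ^ 2)"
proof -
  have "norm (exp b - (\<Sum>k\<le>1. b ^ k / fact k)) \<le> exp \<bar>Re b\<bar> * norm b ^ Suc 1 / fact 1"
    by (rule Taylor_exp)
  also have "\<dots> \<le> exp (norm b) * norm b ^ 2"
    using mult_right_mono[of "exp \<bar>Re b\<bar>" "exp (norm b)" "norm b ^ 2"] abs_Re_le_cmod[of b]
    by (simp add: power2_eq_square)
  finally have 1: "norm (exp b - 1 - b) \<le> exp (norm b) * norm b ^ 2"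
    by (simp add: diff_diff_eq)
  have "exp (a + b) - exp a - b * exp a = exp a * (exp b - 1 - b)"
    by (simp add: exp_add algebra_simps)
  thus ?thesis
    using mult_mono[OF norm_exp[of a] 1] by (simp add: norm_mult)
qed

text \<open>This criterion suits series: quadratic bounds for the remainders of the terms can be
  added, so differentiation under the sum becomes a comparison of sums.\<close>

lemma has_derivative_quadratic_bound:
  fixes F :: "'a::real_normed_vector \<Rightarrow> 'b::real_normed_vector"
  assumes L: "bounded_linear L"
    and b: "\<And>h. norm h \<le> 1 \<Longrightarrow> norm (F (z + h) - F z - L h) \<le> K * norm h ^ 2"
  shows "(F has_derivative L) (at z)"
proof -
  have "((\<lambda>h. norm (F (z + h) - F z - L h) / norm h) \<longlongrightarrow> 0) (at 0)"
  proof (rule Lim_null_comparison)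
    show "((\<lambda>h. K * norm h) \<longlongrightarrow> 0) (at (0::'a))"
      by (auto intro!: tendsto_eq_intros)
    show "\<forall>\<^sub>F h in at 0. norm (norm (F (z + h) - F z - L h) / norm h) \<le> K * norm h"
      unfolding eventually_at
    proof (intro exI[of _ 1] conjI ballI impI)
      fix h :: 'a assume "h \<noteq> 0 \<and> dist h 0 < 1"
      thus "norm (norm (F (z + h) - F z - L h) / norm h) \<le> K * norm h"
        using b[of h] by (simp add: divide_le_eq power2_eq_square mult.assoc)
    qed simp
  qed
  thus ?thesis using L by (simp add: has_derivative_at)
qed

lemma has_sum_sum:
  fixes f :: "'a \<Rightarrow> 'b \<Rightarrow> 'c::topological_comm_monoid_add"
  assumes "finite A" "\<And>a. a \<in> A \<Longrightarrow> (f a has_sum s a) B"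
  shows "((\<lambda>x. \<Sum>a\<in>A. f a x) has_sum (\<Sum>a\<in>A. s a)) B"
  using assms by (induction A rule: finite_induct) (auto intro!: has_sum_add)

lemma has_sum_diff:
  fixes f g :: "'a \<Rightarrow> 'b::topological_ab_group_add"
  assumes "(f has_sum a) A" "(g has_sum b) A"
  shows "((\<lambda>x. f x - g x) has_sum (a - b)) A"
proof -
  have "((\<lambda>x. - g x) has_sum - b) A" using assms(2) by (simp add: has_sum_uminus)
  from has_sum_add[OF assms(1) this] show ?thesis by simp
qed

text \<open>Each term has a Taylor remainder at most a summable constant times
  \<open>norm h ^ 2\<close>; summing over \<open>m\<close> bounds the remainder of the series by
  \<open>K * norm h ^ 2\<close>.\<close>

lemma has_derivative_exp_series:
  fixes c :: "int^'n \<Rightarrow> complex"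
  assumes c: "rapid_decay c"
  shows "(exp_series c has_derivative (\<lambda>v. \<Sum>j\<in>UNIV. v $ j * exp_series (deriv_coeff j c) z)) (at z)"
proof -
  let ?l = "\<lambda>m::int^'n. (\<Sum>i\<in>UNIV. \<bar>real_of_int (m $ i)\<bar>)"
  let ?e = "\<lambda>(m::int^'n) (z::complex^'n). 2 * of_real pi * \<i> * (\<Sum>i\<in>UNIV. int_vec m $ i * z $ i)"
  let ?L = "\<lambda>v::complex^'n. \<Sum>j\<in>UNIV. v $ j * exp_series (deriv_coeff j c) z"
  \<comment> \<open>With \<open>l = 2 * pi * ?l m\<close>, the remainder costs
    \<open>exp (l * norm z)\<close> at the base point, one \<open>exp l\<close> for an increment of
    norm at most 1, and another from \<open>l ^ 2 \<le> 2 * exp l\<close>, which is also the source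
    of the 2 in \<open>K\<close>.\<close>
  define R where "R = 2 * pi * norm z + 4 * pi"
  define K where "K = (\<Sum>\<^sub>\<infinity>m. 2 * (norm (c m) * exp (R * ?l m)))"
  have hs: "((\<lambda>m. c' m * exp (?e m w)) has_sum exp_series c' w) UNIV" if "rapid_decay c'" for c' w
    unfolding exp_series_def by (rule has_sum_infsum[OF summable_on_exp_series[OF that]])
  have e_add: "?e m (w + h) = ?e m w + ?e m h" for m w h
    by (simp add: distrib_left sum.distrib)
  have L_sum: "((\<lambda>m. c m * (?e m h * exp (?e m z))) has_sum ?L h) UNIV" for h
  proof -
    have "((\<lambda>m. \<Sum>j\<in>UNIV. h $ j * (deriv_coeff j c m * exp (?e m z))) has_sum ?L h) UNIV"
      by (intro has_sum_sum finite has_sum_cmult_right hs rapid_decay_deriv_coeff c)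
    moreover have "(\<Sum>j\<in>UNIV. h $ j * (deriv_coeff j c m * exp (?e m z))) = c m * (?e m h * exp (?e m z))" for m
      unfolding deriv_coeff_def sum_distrib_left sum_distrib_right by (simp add: mult_ac)
    ultimately show ?thesis by simp
  qed
  show ?thesis
  proof (rule has_derivative_quadratic_bound)
    show "bounded_linear ?L"
      by (intro bounded_linear_sum bounded_linear_mult_const bounded_linear_vec_nth)
    fix h :: "complex^'n" assume h: "norm h \<le> 1"
    have "((\<lambda>m. c m * exp (?e m (z + h)) - c m * exp (?e m z) - c m * (?e m h * exp (?e m z)))
            has_sum (exp_series c (z + h) - exp_series c z - ?L h)) UNIV"
      by (intro has_sum_diff hs c L_sum)
    moreover have "((\<lambda>m. 2 * (norm (c m) * exp (R * ?l m)) * norm h ^ 2) has_sum (K * norm h ^ 2)) UNIV"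
      unfolding K_def by (intro has_sum_cmult_left has_sum_infsum summable_on_cmult_right rapid_decayD c)
    moreover have "norm (c m * exp (?e m (z + h)) - c m * exp (?e m z) - c m * (?e m h * exp (?e m z)))
        \<le> 2 * (norm (c m) * exp (R * ?l m)) * norm h ^ 2" for m
    proof -
      define l where "l = 2 * pi * ?l m"
      have l0: "l \<ge> 0" unfolding l_def by (intro mult_nonneg_nonneg sum_nonneg) auto
      have bz: "norm (?e m z) \<le> l * norm z" and bh: "norm (?e m h) \<le> l * norm h"
        unfolding l_def by (rule norm_int_vec_pairing_le)+
      have "l * norm h \<le> l" using h l0 by (simp add: mult_left_le)
      hence bh': "norm (?e m h) \<le> l" using bh by simp
      have l2: "l ^ 2 \<le> 2 * exp l"
        using exp_lower_Taylor_quadratic[OF l0] l0 by (simp add: field_simps)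
      have "norm (c m * exp (?e m (z + h)) - c m * exp (?e m z) - c m * (?e m h * exp (?e m z)))
          = norm (c m) * norm (exp (?e m z + ?e m h) - exp (?e m z) - ?e m h * exp (?e m z))"
        unfolding e_add norm_mult[symmetric] by (simp only: right_diff_distrib)
      also have "\<dots> \<le> norm (c m) * (exp (norm (?e m z)) * (exp (norm (?e m h)) * norm (?e m h) ^ 2))"
        by (intro mult_left_mono norm_exp_taylor_le) auto
      also have "\<dots> \<le> norm (c m) * (exp (l * norm z) * (exp l * (l * norm h) ^ 2))"
        using bz bh bh' by (intro mult_left_mono mult_mono power_mono) auto
      also have "\<dots> \<le> norm (c m) * (exp (l * norm z) * (exp l * (2 * exp l * norm h ^ 2)))"
        unfolding power_mult_distrib using l2 by (intro mult_left_mono mult_right_mono) auto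
      also have "\<dots> = 2 * (norm (c m) * (exp (l * norm z) * exp l * exp l)) * norm h ^ 2"
        by (simp only: mult_ac)
      also have "exp (l * norm z) * exp l * exp l = exp (R * ?l m)"
        unfolding exp_add[symmetric] by (rule arg_cong[of _ _ exp]) (simp add: l_def R_def algebra_simps)
      finally show ?thesis .
    qed
    ultimately show "norm (exp_series c (z + h) - exp_series c z - ?L h) \<le> K * norm h ^ 2"
      by (rule norm_infsum_le)
  qed
qed

lemma complex_partial_eqI:
  fixes F :: "complex^'n \<Rightarrow> complex"
  assumes "(F has_derivative (\<lambda>v. \<Sum>j\<in>UNIV. v $ j * G j)) (at z)"
  shows "complex_partial i F z = G i"
proof -
  have "((\<lambda>t. F (z + axis i t)) has_derivative (\<lambda>t. \<Sum>j\<in>UNIV. axis i t $ j * G j)) (at 0)"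
    by (rule has_derivative_compose[where g = F and f = "\<lambda>t. z + axis i t"])
       (use assms in \<open>auto intro!: derivative_eq_intros bounded_linear.has_derivative[OF bounded_linear_axis] simp: axis_eq_0_iff[THEN iffD2]\<close>)
  also have "(\<lambda>t. \<Sum>j\<in>UNIV. axis i t $ j * G j) = (\<lambda>t. G i * t)"
    using sum_mult_axis[of "\<chi> j. G j" i] by (simp add: mult.commute)
  finally have "((\<lambda>t. F (z + axis i t)) has_field_derivative G i) (at 0)"
    by (simp add: has_field_derivative_def)
  thus ?thesis unfolding complex_partial_def by (rule DERIV_imp_deriv)
qed

lemma complex_partial_exp_series:
  "rapid_decay c \<Longrightarrow> complex_partial j (exp_series c) = exp_series (deriv_coeff j c)"
  by (rule ext, rule complex_partial_eqI[OF has_derivative_exp_series])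

lemma has_derivative_exp_series_partial:
  fixes c :: "int^'n \<Rightarrow> complex"
  assumes "rapid_decay c"
  shows "(exp_series c has_derivative (\<lambda>v. \<Sum>j\<in>UNIV. v $ j * complex_partial j (exp_series c) z)) (at z)"
  using has_derivative_exp_series[OF assms] by (simp add: complex_partial_exp_series[OF assms])

section \<open>The theta function\<close>

text \<open>The constant is the minimum of the form on the compact unit sphere; homogeneity of
  degree 2 extends the bound to all vectors.\<close>

lemma positive_definite_lower_bound:
  fixes Y :: "real^'n^'n"
  assumes "\<And>x. x \<noteq> 0 \<Longrightarrow> x \<bullet> (Y *v x) > 0"
  obtains a where "a > 0" "\<And>x. a * (norm x)\<^sup>2 \<le> x \<bullet> (Y *v x)"
proof -
  let ?S = "sphere (0 :: real^'n) 1"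
  have cont: "continuous_on ?S (\<lambda>x. x \<bullet> (Y *v x))"
    by (intro continuous_intros linear_continuous_on matrix_vector_mul_bounded_linear)
  have "?S \<noteq> {}" by simp
  from continuous_attains_inf[OF compact_sphere this cont]
  obtain y where y: "y \<in> ?S" "\<And>x. x \<in> ?S \<Longrightarrow> y \<bullet> (Y *v y) \<le> x \<bullet> (Y *v x)" by blast
  define a where "a = y \<bullet> (Y *v y)"
  have "y \<noteq> 0" using y(1) by auto
  hence "a > 0" unfolding a_def by (rule assms)
  moreover have "a * (norm x)\<^sup>2 \<le> x \<bullet> (Y *v x)" for x
  proof (cases "x = 0")
    case False
    define u where "u = (1 / norm x) *\<^sub>R x"
    have "u \<in> ?S" using False by (simp add: u_def)
    hence "a \<le> u \<bullet> (Y *v u)" unfolding a_def by (rule y(2))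
    also have "\<dots> = (x \<bullet> (Y *v x)) / (norm x)\<^sup>2"
      by (simp add: u_def matrix_vector_mult_scaleR power2_eq_square)
    finally show ?thesis using False by (simp add: pos_le_divide_eq)
  qed simp
  ultimately show ?thesis by (rule that)
qed

definition quad_form :: "complex^'n^'n \<Rightarrow> complex^'n \<Rightarrow> complex^'n \<Rightarrow> complex" where
  "quad_form \<tau> x y = (\<Sum>i\<in>UNIV. \<Sum>j\<in>UNIV. x $ i * \<tau> $ i $ j * y $ j)"

definition theta_coeff :: "complex^'n^'n \<Rightarrow> int^'n \<Rightarrow> complex" where
  "theta_coeff \<tau> m = exp (of_real pi * \<i> * quad_form \<tau> (int_vec m) (int_vec m))"

lemma riemann_theta_eq_exp_series: "riemann_theta \<tau> = exp_series (theta_coeff \<tau>)"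
  by (rule ext) (simp add: riemann_theta_def exp_series_def theta_coeff_def quad_form_def exp_add)

lemma norm_theta_coeff:
  "norm (theta_coeff \<tau> m) = exp (- pi * ((\<chi> i. real_of_int (m $ i)) \<bullet>
     ((\<chi> i j. Im (\<tau> $ i $ j)) *v (\<chi> i. real_of_int (m $ i)))))"
proof -
  have "Im (quad_form \<tau> (int_vec m) (int_vec m)) = (\<chi> i. real_of_int (m $ i)) \<bullet>
     ((\<chi> i j. Im (\<tau> $ i $ j)) *v (\<chi> i. real_of_int (m $ i)))"
    by (simp add: quad_form_def int_vec_def inner_vec_def matrix_vector_mult_def sum_distrib_left mult.assoc)
  thus ?thesis by (simp add: theta_coeff_def)
qed

text \<open>The imaginary part of \<tau> is positive definite, so the coefficients are dominated by
  a Gaussian in \<open>m\<close>. The Gaussian and the exponential of the l1-norm both split over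
  the coordinates, leaving a one-dimensional comparison with a geometric series.\<close>

lemma rapid_decay_theta_coeff:
  fixes \<tau> :: "complex^'n^'n"
  assumes \<tau>: "\<tau> \<in> siegel_upper_half_space"
  shows "rapid_decay (theta_coeff \<tau>)"
  unfolding rapid_decay_def
proof
  fix R :: real
  let ?v = "\<lambda>m::int^'n. \<chi> i. real_of_int (m $ i)"
  let ?Y = "\<chi> i j. Im (\<tau> $ i $ j)"
  let ?l = "\<lambda>m::int^'n. \<Sum>i\<in>UNIV. \<bar>real_of_int (m $ i)\<bar>"
  obtain a where a: "a > 0" "\<And>x. a * (norm x)\<^sup>2 \<le> x \<bullet> (?Y *v x)"
    using positive_definite_lower_bound[of ?Y] \<tau> unfolding siegel_upper_half_space_def by blast
  define b where "b = pi * a"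
  have b: "b > 0" using a by (simp add: b_def)
  \<comment> \<open>The maximum of \<open>- b * x\<^sup>2 + (R + 1) * x\<close>, by completing the
    square. The extra 1 beyond \<open>R\<close> leaves a factor exp (-1) per unit of the
    coordinate's absolute value, and exp (-1) is at most 1/2.\<close>
  define C where "C = (R + 1)\<^sup>2 / (4 * b)"
  have sq: "- b * x\<^sup>2 + (R + 1) * x \<le> C" for x :: real
  proof -
    have "(2 * b * x - (R + 1))\<^sup>2 \<ge> 0" by simp
    hence "(- b * x\<^sup>2 + (R + 1) * x) * (4 * b) \<le> (R + 1)\<^sup>2"
      by (simp add: power2_eq_square algebra_simps)
    thus ?thesis using b by (simp add: C_def pos_le_divide_eq)
  qed
  have e: "exp (- b * (real_of_int k)\<^sup>2 + R * \<bar>real_of_int k\<bar>) \<le> exp C * (1/2) ^ nat \<bar>k\<bar>" for k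
  proof -
    have "exp (- real (nat \<bar>k\<bar>)) = exp (- 1) ^ nat \<bar>k\<bar>"
      by (simp flip: exp_of_nat_mult)
    also have "\<dots> \<le> (1/2 :: real) ^ nat \<bar>k\<bar>"
      using exp_ge_add_one_self[of 1] by (intro power_mono) (simp_all add: exp_minus field_simps)
    finally have 1: "exp (- \<bar>real_of_int k\<bar>) \<le> (1/2) ^ nat \<bar>k\<bar>" by simp
    have "- b * (real_of_int k)\<^sup>2 + R * \<bar>real_of_int k\<bar> \<le> C + - \<bar>real_of_int k\<bar>"
      using sq[of "\<bar>real_of_int k\<bar>"] by (simp add: algebra_simps)
    hence "exp (- b * (real_of_int k)\<^sup>2 + R * \<bar>real_of_int k\<bar>) \<le> exp C * exp (- \<bar>real_of_int k\<bar>)"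
      by (simp flip: exp_add)
    also have "\<dots> \<le> exp C * (1/2) ^ nat \<bar>k\<bar>" using 1 by simp
    finally show ?thesis .
  qed
  show "(\<lambda>m. norm (theta_coeff \<tau> m) * exp (R * ?l m)) summable_on UNIV"
  proof (rule summable_on_bounded)
    show "(\<lambda>m::int^'n. \<Prod>i\<in>UNIV. exp C * (1/2) ^ nat \<bar>m $ i\<bar>) summable_on UNIV"
      by (rule summable_on_prod_vec_nth) (auto intro: summable_on_cmult_right summable_on_int_geometric)
    show "norm (theta_coeff \<tau> m) * exp (R * ?l m) \<le> (\<Prod>i\<in>UNIV. exp C * (1/2) ^ nat \<bar>m $ i\<bar>)" for m
    proof -
      have "pi * (a * (norm (?v m))\<^sup>2) \<le> pi * (?v m \<bullet> (?Y *v ?v m))"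
        using a(2)[of "?v m"] by (intro mult_left_mono) auto
      moreover have "(norm (?v m))\<^sup>2 = (\<Sum>i\<in>UNIV. (real_of_int (m $ i))\<^sup>2)"
        by (simp add: norm_vec_def L2_set_def sum_nonneg)
      ultimately have "- pi * (?v m \<bullet> (?Y *v ?v m)) \<le> - b * (\<Sum>i\<in>UNIV. (real_of_int (m $ i))\<^sup>2)"
        by (simp add: b_def mult.assoc)
      hence "norm (theta_coeff \<tau> m) * exp (R * ?l m)
          \<le> exp (- b * (\<Sum>i\<in>UNIV. (real_of_int (m $ i))\<^sup>2) + R * ?l m)"
        by (simp add: norm_theta_coeff flip: exp_add)
      also have "- b * (\<Sum>i\<in>UNIV. (real_of_int (m $ i))\<^sup>2) + R * ?l m
          = (\<Sum>i\<in>UNIV. - b * (real_of_int (m $ i))\<^sup>2 + R * \<bar>real_of_int (m $ i)\<bar>)"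
        by (simp only: sum_distrib_left sum.distrib)
      also have "exp \<dots> = (\<Prod>i\<in>UNIV. exp (- b * (real_of_int (m $ i))\<^sup>2 + R * \<bar>real_of_int (m $ i)\<bar>))"
        by (rule exp_sum) simp
      also have "\<dots> \<le> (\<Prod>i\<in>UNIV. exp C * (1/2) ^ nat \<bar>m $ i\<bar>)"
        by (intro prod_mono conjI e) simp
      finally show ?thesis .
    qed
  qed simp
qed

lemma has_derivative_riemann_theta:
  assumes "\<tau> \<in> siegel_upper_half_space"
  shows "(riemann_theta \<tau> has_derivative (\<lambda>v. \<Sum>j\<in>UNIV. v $ j * complex_partial j (riemann_theta \<tau>) z)) (at z)"
  unfolding riemann_theta_eq_exp_series
  by (rule has_derivative_exp_series_partial[OF rapid_decay_theta_coeff[OF assms]])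

lemma has_derivative_complex_partial_riemann_theta:
  assumes "\<tau> \<in> siegel_upper_half_space"
  shows "(complex_partial i (riemann_theta \<tau>) has_derivative
     (\<lambda>v. \<Sum>j\<in>UNIV. v $ j * complex_partial j (complex_partial i (riemann_theta \<tau>)) z)) (at z)"
  unfolding riemann_theta_eq_exp_series complex_partial_exp_series[OF rapid_decay_theta_coeff[OF assms]]
  by (rule has_derivative_exp_series_partial[OF rapid_decay_deriv_coeff[OF rapid_decay_theta_coeff[OF assms]]])

section \<open>Quasi-periodicity under the lattice\<close>

lemma int_vec_add: "int_vec (u + v) = int_vec u + int_vec v"
  by (simp add: int_vec_def Finite_Cartesian_Product.vec_eq_iff)

lemma int_vec_uminus: "int_vec (- u) = - int_vec u"
  by (simp add: int_vec_def Finite_Cartesian_Product.vec_eq_iff)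

lemma int_vec_0: "int_vec 0 = 0"
  by (simp add: int_vec_def Finite_Cartesian_Product.vec_eq_iff)

lemma quad_form_add_self:
  assumes "transpose \<tau> = \<tau>"
  shows "quad_form \<tau> (x + y) (x + y) = quad_form \<tau> x x + 2 * quad_form \<tau> x y + quad_form \<tau> y y"
proof -
  have sym: "\<tau> $ i $ j = \<tau> $ j $ i" for i j
    using assms by (metis Finite_Cartesian_Product.transpose_def vec_lambda_beta)
  have "quad_form \<tau> y x = (\<Sum>j\<in>UNIV. \<Sum>i\<in>UNIV. y $ i * \<tau> $ i $ j * x $ j)"
    unfolding quad_form_def by (rule sum.swap)
  also have "\<dots> = quad_form \<tau> x y"
    unfolding quad_form_def by (intro sum.cong refl) (metis sym mult.assoc mult.commute)
  finally have yx: "quad_form \<tau> y x = quad_form \<tau> x y" .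
  have "quad_form \<tau> (x + y) (x + y) = quad_form \<tau> x x + quad_form \<tau> x y + quad_form \<tau> y x + quad_form \<tau> y y"
    by (simp add: quad_form_def distrib_left distrib_right sum.distrib)
  thus ?thesis by (simp add: yx)
qed

text \<open>Completing the square with the symmetric form turns the term of index \<open>m\<close>
  at the shifted point into a constant times the term of index \<open>m + u\<close> at
  \<open>z\<close>; the shift by \<open>v\<close> contributes the exponential of an integer multiple
  of 2 pi i. Reindexing then restores the series.\<close>

lemma riemann_theta_quasi_periodic:
  fixes \<tau> :: "complex^'n^'n"
  assumes "transpose \<tau> = \<tau>"
  shows "riemann_theta \<tau> (z + \<tau> *v int_vec u + int_vec v)
    = exp (- (of_real pi * \<i> * quad_form \<tau> (int_vec u) (int_vec u))
           - 2 * of_real pi * \<i> * (\<Sum>i\<in>UNIV. int_vec u $ i * z $ i)) * riemann_theta \<tau> z"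
proof -
  define p where "p = (\<lambda>x y :: complex^'n. \<Sum>i\<in>UNIV. x $ i * y $ i)"
  define T where "T = (\<lambda>m w. exp (of_real pi * \<i> * quad_form \<tau> (int_vec m) (int_vec m) + 2 * of_real pi * \<i> * p (int_vec m) w))"
  define e where "e = exp (- (of_real pi * \<i> * quad_form \<tau> (int_vec u) (int_vec u)) - 2 * of_real pi * \<i> * p (int_vec u) z)"
  have theta: "riemann_theta \<tau> w = (\<Sum>\<^sub>\<infinity>m. T m w)" for w
    by (simp add: riemann_theta_def T_def quad_form_def p_def)
  have pr: "p x (y + w) = p x y + p x w" "p (x + y) w = p x w + p y w" for x y w
    by (simp_all add: p_def distrib_left distrib_right sum.distrib)
  have pq: "p x (\<tau> *v y) = quad_form \<tau> x y" for x y
    by (simp add: p_def quad_form_def matrix_vector_mult_def sum_distrib_left mult.assoc)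
  have T: "T m (z + \<tau> *v int_vec u + int_vec v) = e * T (m + u) z" for m
  proof -
    have "p (int_vec m) (int_vec v) \<in> \<int>"
      by (auto simp: p_def int_vec_def intro!: Ints_sum Ints_mult)
    then obtain N where "p (int_vec m) (int_vec v) = of_int N" by (rule Ints_cases)
    hence 1: "exp (2 * of_real pi * \<i> * p (int_vec m) (int_vec v)) = 1"
      using exp_integer_2pi[of "real_of_int N"] by (simp add: mult_ac)
    have "T m (z + \<tau> *v int_vec u + int_vec v)
        = exp (of_real pi * \<i> * quad_form \<tau> (int_vec m) (int_vec m)
            + 2 * of_real pi * \<i> * (p (int_vec m) z + quad_form \<tau> (int_vec m) (int_vec u)))
          * exp (2 * of_real pi * \<i> * p (int_vec m) (int_vec v))"
      by (simp add: T_def pr pq distrib_left add.assoc flip: exp_add)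
    also have "\<dots> = e * T (m + u) z"
      unfolding 1 T_def e_def int_vec_add quad_form_add_self[OF assms] pr exp_add[symmetric] mult_1_right
      by (rule arg_cong[of _ _ exp]) (simp add: algebra_simps)
    finally show ?thesis .
  qed
  have "riemann_theta \<tau> (z + \<tau> *v int_vec u + int_vec v) = e * (\<Sum>\<^sub>\<infinity>m. T (m + u) z)"
    unfolding theta T by (rule infsum_cmult_right')
  also have "bij (\<lambda>m. m + u)"
    by (rule bij_betw_byWitness[where f' = "\<lambda>m. m - u"]) auto
  hence "(\<Sum>\<^sub>\<infinity>m. T (m + u) z) = riemann_theta \<tau> z"
    unfolding theta by (rule infsum_reindex_bij_betw)
  finally show ?thesis by (simp add: e_def p_def)
qed

text \<open>Differentiate both sides of the quasi-periodicity relation. At a zero, the product rule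
  keeps only the automorphy factor times the derivative of theta.\<close>

lemma complex_partial_riemann_theta_quasi_periodic:
  fixes \<tau> :: "complex^'n^'n"
  assumes \<tau>: "\<tau> \<in> siegel_upper_half_space" and z: "riemann_theta \<tau> z = 0"
  obtains e where "e \<noteq> 0"
    "\<And>j. complex_partial j (riemann_theta \<tau>) (z + \<tau> *v int_vec u + int_vec v)
       = e * complex_partial j (riemann_theta \<tau>) z"
proof -
  define d where "d = \<tau> *v int_vec u + int_vec v"
  define E where "E = (\<lambda>z. exp (- (of_real pi * \<i> * quad_form \<tau> (int_vec u) (int_vec u))
           - 2 * of_real pi * \<i> * (\<Sum>i\<in>UNIV. int_vec u $ i * z $ i)))"
  have "transpose \<tau> = \<tau>" using \<tau> by (simp add: siegel_upper_half_space_def)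
  hence qp: "riemann_theta \<tau> (w + d) = E w * riemann_theta \<tau> w" for w
    using riemann_theta_quasi_periodic[of \<tau> w u v] by (simp add: E_def d_def add.assoc)
  let ?L = "\<lambda>z v. \<Sum>j\<in>UNIV. v $ j * complex_partial j (riemann_theta \<tau>) z"
  have "((\<lambda>w. riemann_theta \<tau> (w + d)) has_derivative ?L (z + d)) (at z)"
    by (rule has_derivative_compose[where f = "\<lambda>w. w + d"])
       (auto intro!: derivative_eq_intros has_derivative_riemann_theta[OF \<tau>])
  hence 1: "((\<lambda>w. E w * riemann_theta \<tau> w) has_derivative ?L (z + d)) (at z)"
    by (simp only: qp)
  \<comment> \<open>The derivative of \<open>E\<close> gets multiplied by the value 0 of theta at
    \<open>z\<close>, so its existence is enough.\<close>
  have "(\<lambda>z::complex^'n. - (of_real pi * \<i> * quad_form \<tau> (int_vec u) (int_vec u))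
           - 2 * of_real pi * \<i> * (\<Sum>i\<in>UNIV. int_vec u $ i * z $ i)) differentiable (at z)"
    by (intro differentiable_diff differentiable_const differentiable_mult differentiable_sum
        bounded_linear_imp_differentiable bounded_linear_vec_nth finite ballI)
  then obtain B' where "((\<lambda>z::complex^'n. - (of_real pi * \<i> * quad_form \<tau> (int_vec u) (int_vec u))
           - 2 * of_real pi * \<i> * (\<Sum>i\<in>UNIV. int_vec u $ i * z $ i)) has_derivative B') (at z)"
    unfolding differentiable_def by blast
  from has_derivative_compose[OF this DERIV_exp[unfolded has_field_derivative_def]]
  obtain E' where "(E has_derivative E') (at z)" unfolding E_def by blast
  from has_derivative_mult[OF this has_derivative_riemann_theta[OF \<tau>, of z]]
  have 2: "((\<lambda>w. E w * riemann_theta \<tau> w) has_derivative (\<lambda>v. E z * ?L z v)) (at z)"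
    by (simp add: z)
  have eq: "?L (z + d) v = E z * ?L z v" for v
    using has_derivative_unique[OF 1 2] by (rule fun_cong)
  have ax: "?L w (axis j 1) = complex_partial j (riemann_theta \<tau>) w" for w j
    using sum_mult_axis[of "\<chi> i. complex_partial i (riemann_theta \<tau>) w" j] by (simp add: mult.commute)
  show ?thesis
  proof (rule that[of "E z"])
    show "E z \<noteq> 0" by (simp add: E_def)
    show "complex_partial j (riemann_theta \<tau>) (z + \<tau> *v int_vec u + int_vec v) = E z * complex_partial j (riemann_theta \<tau>) z" for j
      using eq[of "axis j 1"] unfolding ax by (simp add: d_def add.assoc)
  qed
qed

section \<open>Derivatives within a smooth zero locus\<close>

text \<open>A zero of \<open>s \<mapsto> f (z + t v + s e\<^sub>k)\<close> is a fixed point of \<open>s \<mapsto> s - f (z + t v + s e\<^sub>k) / g\<^sub>k\<close>; when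
  \<open>v\<close> is in the kernel of the differential, this map sends the disc of radius \<open>\<epsilon> t\<close> to itself, since its value
  is \<open>o(t)\<close>.\<close>

lemma zero_near_tangent_direction:
  fixes f :: "complex^'n \<Rightarrow> complex"
  assumes cont: "continuous_on UNIV f" and z: "f z = 0"
    and der: "(f has_derivative (\<lambda>v. \<Sum>i\<in>UNIV. g $ i * v $ i)) (at z)"
    and k: "g $ k \<noteq> 0" and v: "(\<Sum>i\<in>UNIV. g $ i * v $ i) = 0" and \<epsilon>: "\<epsilon> > 0"
  obtains \<delta> where "\<delta> > 0"
    "\<And>t. 0 < t \<Longrightarrow> t < \<delta> \<Longrightarrow> \<exists>s. norm s \<le> \<epsilon> * t \<and> f (z + (t *\<^sub>R v + axis k s)) = 0"
proof -
  define N where "N = norm v + \<epsilon>"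
  have N: "N > 0" using \<epsilon> by (simp add: N_def add_nonneg_pos)
  \<comment> \<open>The displacement has length at most \<open>t * N\<close>, so this tolerance
    keeps the linearisation error below \<open>norm (g $ k) * (\<epsilon> * t)\<close>; division by
    \<open>g $ k\<close> gives the radius of the disc.\<close>
  define \<eta> where "\<eta> = \<epsilon> * norm (g $ k) / N"
  have \<eta>: "\<eta> > 0" using \<epsilon> k N by (simp add: \<eta>_def)
  obtain d where d: "d > 0" and
    dd: "\<And>y. norm (y - z) < d \<Longrightarrow> norm (f y - f z - (\<Sum>i\<in>UNIV. g $ i * (y - z) $ i)) \<le> \<eta> * norm (y - z)"
    using der \<eta> unfolding has_derivative_at_alt by blast
  show ?thesis
  proof (rule that[of "d / N"])
    show "d / N > 0" using d N by simp
    fix t :: real assume t: "0 < t" "t < d / N"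
    define y where "y = (\<lambda>s. t *\<^sub>R v + axis k s)"
    define \<phi> where "\<phi> = (\<lambda>s. s - f (z + y s) / g $ k)"
    have cy: "continuous_on A y" for A
      unfolding y_def
      by (intro continuous_on_add continuous_on_const linear_continuous_on bounded_linear_axis)
    have maps: "\<phi> s \<in> cball 0 (\<epsilon> * t)" if s: "s \<in> cball 0 (\<epsilon> * t)" for s
    proof -
      have "norm (y s) \<le> norm (t *\<^sub>R v) + norm (axis k s)"
        unfolding y_def by (rule norm_triangle_ineq)
      also have "\<dots> \<le> t * norm v + \<epsilon> * t"
        using s t by (simp add: norm_axis)
      also have "\<dots> = t * N" by (simp add: N_def algebra_simps)
      finally have yN: "norm (y s) \<le> t * N" .
      also have "t * N < d" using t N by (simp add: pos_less_divide_eq)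
      finally have yd: "norm (z + y s - z) < d" by simp
      have "y s $ i = of_real t * v $ i + axis k s $ i" for i
        by (simp add: y_def scaleR_conv_of_real[of t "v $ i"])
      hence "(\<Sum>i\<in>UNIV. g $ i * (y s) $ i) = of_real t * (\<Sum>i\<in>UNIV. g $ i * v $ i) + (\<Sum>i\<in>UNIV. g $ i * axis k s $ i)"
        by (simp add: distrib_left sum.distrib sum_distrib_left mult.left_commute)
      also have "\<dots> = g $ k * s" using v sum_mult_axis[of g k s] by simp
      finally have "norm (f (z + y s) - g $ k * s) \<le> \<eta> * norm (y s)"
        using dd[OF yd] z by simp
      also have "\<dots> \<le> \<eta> * (t * N)" using yN \<eta> by (intro mult_left_mono) auto
      also have "\<dots> = norm (g $ k) * (\<epsilon> * t)" using N by (simp add: \<eta>_def)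
      finally have "norm (g $ k * s - f (z + y s)) \<le> norm (g $ k) * (\<epsilon> * t)"
        by (simp add: norm_minus_commute)
      moreover have "g $ k * s - f (z + y s) = g $ k * \<phi> s"
        using k by (simp add: \<phi>_def right_diff_distrib)
      ultimately have "norm (g $ k) * norm (\<phi> s) \<le> norm (g $ k) * (\<epsilon> * t)"
        by (simp add: norm_mult)
      thus ?thesis using k by simp
    qed
    have contphi: "continuous_on (cball 0 (\<epsilon> * t)) \<phi>"
      unfolding \<phi>_def
      by (intro continuous_on_diff continuous_on_id continuous_on_divide continuous_on_const
            continuous_on_compose2[OF cont] continuous_on_add cy) (use k in auto)
    have nonempty: "cball (0::complex) (\<epsilon> * t) \<noteq> {}" using \<epsilon> t by (simp add: not_less)
    \<comment> \<open>\<open>f\<close> is assumed differentiable at \<open>z\<close> alone, so there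
      is no contraction estimate for \<open>\<phi>\<close>; Brouwer's theorem asks only for
      continuity.\<close>
    obtain s where s: "s \<in> cball 0 (\<epsilon> * t)" "\<phi> s = s"
      by (rule brouwer[OF compact_cball convex_cball nonempty contphi]) (use maps in auto)
    hence "f (z + y s) = 0" using k by (simp add: \<phi>_def)
    thus "\<exists>s. norm s \<le> \<epsilon> * t \<and> f (z + (t *\<^sub>R v + axis k s)) = 0"
      using s unfolding y_def by auto
  qed
qed

text \<open>The difference \<open>E\<close> is a derivative of the constant 0 within
  \<open>S\<close>, so \<open>E y\<close> is o(norm y) when \<open>z + y \<in> S\<close>. Take y = t
  v + s e_k with \<open>z + y\<close> a zero and norm s at most \<epsilon> t. Then t E v = E y - E
  (s e_k), where both parts are of order \<epsilon> t; divide by t and let \<epsilon> tend to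
  0.\<close>

lemma has_derivative_within_unique_on_tangent:
  fixes f :: "complex^'n \<Rightarrow> complex" and F :: "complex^'n \<Rightarrow> 'b::real_normed_vector"
  assumes cont: "continuous_on UNIV f" and z: "f z = 0"
    and der: "(f has_derivative (\<lambda>v. \<Sum>i\<in>UNIV. g $ i * v $ i)) (at z)"
    and k: "g $ k \<noteq> 0" and v: "(\<Sum>i\<in>UNIV. g $ i * v $ i) = 0"
    and r: "r > 0" and S: "\<And>w. dist w z < r \<Longrightarrow> f w = 0 \<Longrightarrow> w \<in> S"
    and D: "(F has_derivative D) (at z within S)" and D': "(F has_derivative D') (at z within S)"
  shows "D v = D' v"
proof -
  define E where "E = (\<lambda>v. D v - D' v)"
  have E: "((\<lambda>_. 0::'b) has_derivative E) (at z within S)"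
    using has_derivative_diff[OF D D'] by (simp add: E_def)
  hence bl: "bounded_linear E" by (rule has_derivative_bounded_linear)
  then obtain B where B: "B > 0" "\<And>x. norm (E x) \<le> norm x * B"
    using bounded_linear.pos_bounded by blast
  have small: "norm (E v) \<le> \<epsilon> * (norm v + 1 + B)" if \<epsilon>: "0 < \<epsilon>" "\<epsilon> \<le> 1" for \<epsilon>
  proof -
    obtain d where d: "d > 0"
      and dd: "\<And>y. y \<in> S \<Longrightarrow> norm (y - z) < d \<Longrightarrow> norm (E (y - z)) \<le> \<epsilon> * norm (y - z)"
      using E \<epsilon>(1) unfolding has_derivative_within_alt by auto
    obtain \<delta> where \<delta>: "\<delta> > 0"
      and zero: "\<And>t. 0 < t \<Longrightarrow> t < \<delta> \<Longrightarrow> \<exists>s. norm s \<le> \<epsilon> * t \<and> f (z + (t *\<^sub>R v + axis k s)) = 0"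
      using zero_near_tangent_direction[OF cont z der k v \<epsilon>(1)] by blast
    define N where "N = norm v + 1"
    have N: "N > 0" by (simp add: N_def add_nonneg_pos)
    \<comment> \<open>Small enough for the zero to exist and, as \<open>norm y \<le> t * N\<close>,
      for \<open>z + y\<close> to lie within both \<open>d\<close> and \<open>r\<close> of
      \<open>z\<close>; the halves make the inequalities strict.\<close>
    define t where "t = min (\<delta> / 2) (min d r / (2 * N))"
    have t: "0 < t" "t < \<delta>" using \<delta> d r N by (auto simp: t_def)
    have "t \<le> min d r / (2 * N)" by (simp add: t_def)
    hence "2 * (t * N) \<le> min d r" using N by (simp add: pos_le_divide_eq mult_ac)
    moreover have "t * N > 0" using t N by simp
    ultimately have tN: "t * N < d" "t * N < r" by linarith+
    obtain s where s: "norm s \<le> \<epsilon> * t" and fs: "f (z + (t *\<^sub>R v + axis k s)) = 0"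
      using zero[OF t] by blast
    define y where "y = t *\<^sub>R v + axis k s"
    have "norm y \<le> norm (t *\<^sub>R v) + norm (axis k s)"
      unfolding y_def by (rule norm_triangle_ineq)
    also have "\<dots> \<le> t * norm v + 1 * t"
      using s t \<epsilon> by (intro add_mono order.trans[OF _ mult_right_mono[of \<epsilon> 1 t]]) (simp_all add: norm_axis)
    also have "\<dots> = t * N" by (simp add: N_def algebra_simps)
    finally have yN: "norm y \<le> t * N" .
    have "z + y \<in> S" by (rule S) (use yN tN fs in \<open>auto simp: dist_norm y_def\<close>)
    hence "norm (E y) \<le> \<epsilon> * norm y" using dd[of "z + y"] yN tN by simp
    also have "\<dots> \<le> \<epsilon> * (t * N)" using yN \<epsilon> by (intro mult_left_mono) auto
    finally have Ey: "norm (E y) \<le> \<epsilon> * (t * N)" .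
    have "norm (E (axis k s)) \<le> norm (axis k s :: complex^'n) * B" by (rule B(2))
    also have "\<dots> \<le> (\<epsilon> * t) * B" using s B(1) by (intro mult_right_mono) (auto simp: norm_axis)
    finally have Es: "norm (E (axis k s)) \<le> \<epsilon> * t * B" .
    have "E (t *\<^sub>R v) = E y - E (axis k s)"
      using linear_diff[OF bounded_linear.linear[OF bl], of y "axis k s"] by (simp add: y_def)
    hence "t *\<^sub>R E v = E y - E (axis k s)"
      using linear_cmul[OF bounded_linear.linear[OF bl], of t v] by simp
    hence "norm (t *\<^sub>R E v) \<le> norm (E y) + norm (E (axis k s))"
      by (simp only: norm_triangle_ineq4)
    hence "t * norm (E v) \<le> \<epsilon> * (t * N) + \<epsilon> * t * B" using Ey Es t by simp
    also have "\<dots> = t * (\<epsilon> * (norm v + 1 + B))" by (simp add: N_def algebra_simps)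
    finally show ?thesis using t by simp
  qed
  have "norm (E v) \<le> 0"
  proof (rule field_le_epsilon)
    fix e :: real assume e: "e > 0"
    define M where "M = norm v + 1 + B"
    have M: "M > 0" using B(1) by (simp add: M_def add_nonneg_pos)
    define \<epsilon> where "\<epsilon> = min 1 (e / M)"
    have "0 < \<epsilon>" "\<epsilon> \<le> 1" "\<epsilon> * M \<le> e"
      using e M by (auto simp: \<epsilon>_def min_def field_simps)
    thus "norm (E v) \<le> 0 + e" using small[of \<epsilon>] by (simp add: M_def)
  qed
  thus ?thesis by (simp add: E_def)
qed

section \<open>The Gauss map\<close>

lemma equiv_lattice_rel: "equiv UNIV (lattice_rel \<tau>)"
proof (rule equivI)
  show "refl_on UNIV (lattice_rel \<tau>)"
  proof (rule refl_onI)
    fix z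
    have "\<exists>u v. z = z + \<tau> *v int_vec u + int_vec v"
      by (rule exI[of _ 0], rule exI[of _ 0]) (simp add: int_vec_0)
    thus "(z, z) \<in> lattice_rel \<tau>" by (simp add: lattice_rel_def)
  qed
  show "sym (lattice_rel \<tau>)"
  proof (rule symI)
    fix z w assume "(z, w) \<in> lattice_rel \<tau>"
    then obtain u v where "w = z + \<tau> *v int_vec u + int_vec v" by (auto simp: lattice_rel_def)
    hence "z = w + \<tau> *v int_vec (- u) + int_vec (- v)"
      by (simp add: int_vec_uminus matrix_vector_mult_diff_distrib[of \<tau> 0, simplified])
    thus "(w, z) \<in> lattice_rel \<tau>" unfolding lattice_rel_def by blast
  qed
  show "trans (lattice_rel \<tau>)"
  proof (rule transI)
    fix z w y assume "(z, w) \<in> lattice_rel \<tau>" "(w, y) \<in> lattice_rel \<tau>"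
    then obtain u v u' v' where "w = z + \<tau> *v int_vec u + int_vec v" "y = w + \<tau> *v int_vec u' + int_vec v'"
      by (auto simp: lattice_rel_def)
    hence "y = z + \<tau> *v int_vec (u + u') + int_vec (v + v')"
      by (simp add: int_vec_add matrix_vector_right_distrib)
    thus "(z, y) \<in> lattice_rel \<tau>" unfolding lattice_rel_def by blast
  qed
qed simp

lemma complex_torus_eq_torus_point:
  assumes "x \<in> complex_torus \<tau>" "z \<in> x"
  shows "x = torus_point \<tau> z"
proof -
  obtain w where x: "x = lattice_rel \<tau> `` {w}"
    using assms(1) by (auto simp: complex_torus_def elim: quotientE)
  hence "(w, z) \<in> lattice_rel \<tau>" using assms(2) by simp
  thus ?thesis unfolding torus_point_def x by (rule equiv_class_eq[OF equiv_lattice_rel])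
qed

lemma torus_point_in_complex_torus: "torus_point \<tau> z \<in> complex_torus \<tau>"
  by (simp add: complex_torus_def torus_point_def quotientI)

lemma self_in_torus_point: "z \<in> torus_point \<tau> z"
  unfolding torus_point_def by (rule equiv_class_self[OF equiv_lattice_rel UNIV_I])

lemma in_torus_pointE:
  assumes "w \<in> torus_point \<tau> z"
  obtains u v where "w = z + \<tau> *v int_vec u + int_vec v"
  using assms by (auto simp: torus_point_def lattice_rel_def)

lemma has_derivative_vecI:
  fixes F :: "'a::real_normed_vector \<Rightarrow> 'b::euclidean_space^'n"
  assumes "\<And>j. ((\<lambda>w. F w $ j) has_derivative (\<lambda>v. L v $ j)) (at z within S)"
  shows "(F has_derivative L) (at z within S)"
  unfolding has_derivative_componentwise_within[of F]
proof
  fix b :: "'b^'n" assume "b \<in> Basis"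
  then obtain j c where b: "b = axis j c" by (auto simp: Basis_vec_def)
  show "((\<lambda>x. F x \<bullet> b) has_derivative (\<lambda>x. L x \<bullet> b)) (at z within S)"
    unfolding b inner_axis by (rule has_derivative_inner_left[OF assms])
qed

section \<open>Smooth points, charts and the tangent map in terms of the gradient\<close>

definition theta_gradient :: "complex^'n^'n \<Rightarrow> complex^'n \<Rightarrow> complex^'n" where
  "theta_gradient \<tau> z = (\<chi> i. complex_partial i (riemann_theta \<tau>) z)"

context
  fixes \<tau> :: "complex^'n^'n"
  assumes \<tau>: "\<tau> \<in> siegel_upper_half_space"
begin

lemma riemann_theta_has_derivative_gradient:
  "(riemann_theta \<tau> has_derivative (\<lambda>v. \<Sum>i\<in>UNIV. theta_gradient \<tau> z $ i * v $ i)) (at z)"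
  using has_derivative_riemann_theta[OF \<tau>, of z] by (simp add: theta_gradient_def mult.commute)

lemma torus_point_in_theta_divisor_iff:
  "torus_point \<tau> z \<in> theta_divisor \<tau> \<longleftrightarrow> riemann_theta \<tau> z = 0"
proof
  assume "torus_point \<tau> z \<in> theta_divisor \<tau>"
  then obtain w where w: "w \<in> torus_point \<tau> z" "riemann_theta \<tau> w = 0" by (auto simp: theta_divisor_def)
  from w(1) obtain u v where "w = z + \<tau> *v int_vec u + int_vec v" by (rule in_torus_pointE)
  thus "riemann_theta \<tau> z = 0"
    using w(2) riemann_theta_quasi_periodic[of \<tau> z u v] \<tau> by (simp add: siegel_upper_half_space_def)
next
  assume "riemann_theta \<tau> z = 0"
  thus "torus_point \<tau> z \<in> theta_divisor \<tau>"
    using self_in_torus_point torus_point_in_complex_torus by (auto simp: theta_divisor_def)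
qed

text \<open>The representative picked by \<open>SOME\<close> differs from \<open>z\<close> by a
  lattice vector, so its gradient is a nonzero multiple of the one at \<open>z\<close> and has the
  same kernel.\<close>

lemma theta_tangent_torus_point:
  assumes z: "riemann_theta \<tau> z = 0"
  shows "theta_tangent \<tau> (torus_point \<tau> z) = {v. (\<Sum>i\<in>UNIV. theta_gradient \<tau> z $ i * v $ i) = 0}"
proof -
  define w where "w = (SOME w. w \<in> torus_point \<tau> z)"
  have "w \<in> torus_point \<tau> z" unfolding w_def by (rule someI) (rule self_in_torus_point)
  then obtain u v where w: "w = z + \<tau> *v int_vec u + int_vec v" by (rule in_torus_pointE)
  obtain e where "e \<noteq> 0" "\<And>j. complex_partial j (riemann_theta \<tau>) w = e * complex_partial j (riemann_theta \<tau>) z"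
    using complex_partial_riemann_theta_quasi_periodic[OF \<tau> z] unfolding w by blast
  hence "(\<Sum>i\<in>UNIV. theta_gradient \<tau> w $ i * y $ i) = e * (\<Sum>i\<in>UNIV. theta_gradient \<tau> z $ i * y $ i)" for y
    by (simp add: theta_gradient_def sum_distrib_left mult.assoc)
  thus ?thesis using \<open>e \<noteq> 0\<close>
    unfolding theta_tangent_def w_def[symmetric]
      frechet_derivative_at[OF riemann_theta_has_derivative_gradient, symmetric] by simp
qed

lemma torus_point_in_theta_smooth_iff:
  "torus_point \<tau> z \<in> theta_smooth \<tau> \<longleftrightarrow> riemann_theta \<tau> z = 0 \<and> theta_gradient \<tau> z \<noteq> 0"
proof -
  have "vec.dim (theta_tangent \<tau> (torus_point \<tau> z)) = CARD('n) - 1 \<longleftrightarrow> theta_gradient \<tau> z \<noteq> 0"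
    if z: "riemann_theta \<tau> z = 0"
  proof (cases "theta_gradient \<tau> z = 0")
    case True
    hence "theta_tangent \<tau> (torus_point \<tau> z) = UNIV" by (simp add: theta_tangent_torus_point[OF z])
    hence "vec.dim (theta_tangent \<tau> (torus_point \<tau> z)) = CARD('n)" by (simp only: vec_dim_card)
    \<comment> \<open>The subtraction is truncated, so positivity of \<open>CARD('n)\<close> is what
      separates the two dimensions.\<close>
    moreover have "CARD('n) \<noteq> CARD('n) - 1" using zero_less_card_finite[where 'a = 'n] by linarith
    ultimately show ?thesis using True by simp
  qed (simp add: theta_tangent_torus_point[OF z] dim_hyperplane)
  thus ?thesis by (auto simp: theta_smooth_def torus_point_in_theta_divisor_iff)
qed

lemma gauss_map_in_chart_domain_iff:
  assumes "torus_point \<tau> z \<in> theta_smooth \<tau>"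
  shows "gauss_map \<tau> (torus_point \<tau> z) \<in> chart_domain k \<longleftrightarrow> theta_gradient \<tau> z $ k \<noteq> 0"
proof -
  have z: "riemann_theta \<tau> z = 0" "theta_gradient \<tau> z \<noteq> 0"
    using assms by (simp_all add: torus_point_in_theta_smooth_iff)
  thus ?thesis
    by (simp add: gauss_map_def theta_tangent_torus_point chart_domain_def dual_projective_space_def
        subspace_hyperplane dim_hyperplane sum_mult_axis)
qed

text \<open>On \<open>S\<close> near \<open>z\<close> the chart expression is the quotient
  \<open>\<Phi>\<close>, whose derivative \<open>L\<close> comes from the quotient rule. The
  selected derivative may differ from \<open>L\<close>, but both are derivatives within
  \<open>S\<close> and hence agree on tangent vectors.\<close>

lemma gauss_differential_on_tangent:
  assumes z: "torus_point \<tau> z \<in> theta_smooth \<tau>" and k: "theta_gradient \<tau> z $ k \<noteq> 0"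
    and v: "(\<Sum>i\<in>UNIV. theta_gradient \<tau> z $ i * v $ i) = 0"
  defines "P \<equiv> \<lambda>j. \<Sum>i\<in>UNIV. complex_partial i (complex_partial j (riemann_theta \<tau>)) z * v $ i"
  shows "gauss_differential \<tau> k z v = (\<chi> j. (P j * theta_gradient \<tau> z $ k - theta_gradient \<tau> z $ j * P k)
     / (theta_gradient \<tau> z $ k * theta_gradient \<tau> z $ k))"
proof -
  define S where "S = {w. torus_point \<tau> w \<in> theta_smooth \<tau>}"
  define F where "F = (\<lambda>w. hyperplane_chart k (gauss_map \<tau> (torus_point \<tau> w)))"
  define \<Phi> where "\<Phi> = (\<lambda>w. \<chi> j. theta_gradient \<tau> w $ j / theta_gradient \<tau> w $ k)"
  define Q where "Q = (\<lambda>j v. \<Sum>i\<in>UNIV. v $ i * complex_partial i (complex_partial j (riemann_theta \<tau>)) z)"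
  define L where "L = (\<lambda>v. \<chi> j. (Q j v * theta_gradient \<tau> z $ k - theta_gradient \<tau> z $ j * Q k v)
     / (theta_gradient \<tau> z $ k * theta_gradient \<tau> z $ k))"
  have grad: "((\<lambda>w. theta_gradient \<tau> w $ j) has_derivative Q j) (at z)" for j
    using has_derivative_complex_partial_riemann_theta[OF \<tau>, of j z] by (simp add: theta_gradient_def Q_def)
  have "isCont (\<lambda>w. theta_gradient \<tau> w $ k) z" by (rule has_derivative_continuous[OF grad])
  from continuous_at_avoid[OF this k]
  obtain r where r: "r > 0" "\<And>w. dist w z < r \<Longrightarrow> theta_gradient \<tau> w $ k \<noteq> 0"
    by (auto simp: dist_commute)
  have "((\<lambda>w. \<Phi> w $ j) has_derivative (\<lambda>v. L v $ j)) (at z within S)" for j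
    unfolding \<Phi>_def L_def vec_lambda_beta
    by (rule has_derivative_at_withinI, rule has_derivative_divide'[OF grad grad k])
  hence \<Phi>: "(\<Phi> has_derivative L) (at z within S)" by (rule has_derivative_vecI)
  have F\<Phi>: "F w = \<Phi> w" if "w \<in> S" "dist w z < r" for w
    using that r(2)[OF that(2)]
    by (simp add: F_def \<Phi>_def S_def torus_point_in_theta_smooth_iff gauss_map_def theta_tangent_torus_point
        hyperplane_chart_hyperplane)
  \<comment> \<open>\<open>F\<close> and \<open>\<Phi>\<close> are compared only on
    \<open>S\<close>: away from the divisor \<open>theta_tangent\<close> may depend on the chosen
    representative.\<close>
  have F: "(F has_derivative L) (at z within S)"
    by (rule has_derivative_transform_within[OF \<Phi> r(1)]) (use F\<Phi> z in \<open>auto simp: S_def\<close>)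
  hence fd: "(F has_derivative frechet_derivative F (at z within S)) (at z within S)"
    using frechet_derivative_works differentiableI by blast
  have "gauss_differential \<tau> k z v = frechet_derivative F (at z within S) v"
    by (simp add: gauss_differential_def F_def S_def)
  also have "\<dots> = L v"
  proof (rule has_derivative_within_unique_on_tangent[where S = S, OF _ _ riemann_theta_has_derivative_gradient k v r(1) _ fd F])
    show "continuous_on UNIV (riemann_theta \<tau>)"
      using has_derivative_continuous[OF riemann_theta_has_derivative_gradient]
      by (auto simp: continuous_on_eq_continuous_at)
    show "riemann_theta \<tau> z = 0" using z by (simp add: torus_point_in_theta_smooth_iff)
    \<comment> \<open>Within \<open>r\<close> of \<open>z\<close> the \<open>k\<close>-th partial is
      nonzero, so every zero of theta there is a smooth point.\<close>
    show "w \<in> S" if "dist w z < r" "riemann_theta \<tau> w = 0" for w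
      using that r(2)[OF that(1)] by (auto simp: S_def torus_point_in_theta_smooth_iff)
  qed
  also have "\<dots> = (\<chi> j. (P j * theta_gradient \<tau> z $ k - theta_gradient \<tau> z $ j * P k)
     / (theta_gradient \<tau> z $ k * theta_gradient \<tau> z $ k))"
    by (simp add: L_def P_def Q_def mult.commute)
  finally show ?thesis .
qed

lemma gauss_differential_bij_iff:
  assumes z: "torus_point \<tau> z \<in> theta_smooth \<tau>" and k: "theta_gradient \<tau> z $ k \<noteq> 0"
  shows "\<not> bij_betw (gauss_differential \<tau> k z) (theta_tangent \<tau> (torus_point \<tau> z)) (chart_tangent k)
     \<longleftrightarrow> eta \<tau> z = 0"
proof -
  define h :: "complex^'n^'n" where "h = (\<chi> i j. complex_partial i (complex_partial j (riemann_theta \<tau>)) z)"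
  define L where "L = (\<lambda>v. \<chi> j. ((\<chi> j. \<Sum>i\<in>UNIV. h $ i $ j * v $ i) $ j * theta_gradient \<tau> z $ k
      - theta_gradient \<tau> z $ j * (\<chi> j. \<Sum>i\<in>UNIV. h $ i $ j * v $ i) $ k)
     / (theta_gradient \<tau> z $ k * theta_gradient \<tau> z $ k))"
  have T: "theta_tangent \<tau> (torus_point \<tau> z) = {v. (\<Sum>i\<in>UNIV. theta_gradient \<tau> z $ i * v $ i) = 0}"
    using z by (simp add: torus_point_in_theta_smooth_iff theta_tangent_torus_point)
  \<comment> \<open>\<open>bij_betw\<close> looks only at values on the tangent space, which is
    where the differential is known.\<close>
  have "bij_betw (gauss_differential \<tau> k z) (theta_tangent \<tau> (torus_point \<tau> z)) (chart_tangent k)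
     \<longleftrightarrow> bij_betw L (theta_tangent \<tau> (torus_point \<tau> z)) (chart_tangent k)"
    by (rule bij_betw_cong) (use gauss_differential_on_tangent[OF z k] in \<open>simp add: T L_def h_def\<close>)
  also have "\<not> \<dots> \<longleftrightarrow> (\<Sum>i\<in>UNIV. \<Sum>j\<in>UNIV. theta_gradient \<tau> z $ i * cofactor_matrix h $ i $ j * theta_gradient \<tau> z $ j) = 0"
    unfolding T L_def by (rule bij_betw_hyperplane_iff[OF k])
  also have "\<dots> \<longleftrightarrow> eta \<tau> z = 0"
    by (simp add: eta_def Let_def h_def theta_gradient_def)
  finally show ?thesis .
qed

end

theorem theorem3p1:
  fixes \<tau> :: "complex^'n^'n"
  assumes "\<tau> \<in> siegel_upper_half_space"
  shows "eta_zero_locus \<tau> \<inter> theta_smooth \<tau> = gauss_ramification_locus \<tau>"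
proof -
  \<comment> \<open>The equivalence holds for each \<open>z\<close> over \<open>x\<close>
    separately: every chart around the image gives the same criterion, and a nonzero gradient
    provides at least one chart.\<close>
  have pointwise: "(\<exists>z\<in>x. eta \<tau> z = 0) \<longleftrightarrow> (\<exists>z\<in>x. \<exists>k. gauss_map \<tau> x \<in> chart_domain k \<and>
        \<not> bij_betw (gauss_differential \<tau> k z) (theta_tangent \<tau> x) (chart_tangent k))"
    if x: "x \<in> theta_smooth \<tau>" for x
  proof (rule bex_cong[OF refl])
    fix z assume z: "z \<in> x"
    have xz: "x = torus_point \<tau> z"
      by (rule complex_torus_eq_torus_point[OF _ z]) (use x in \<open>simp add: theta_smooth_def theta_divisor_def\<close>)
    have zs: "torus_point \<tau> z \<in> theta_smooth \<tau>" using x xz by simp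
    then obtain k where k: "theta_gradient \<tau> z $ k \<noteq> 0"
      by (auto simp: torus_point_in_theta_smooth_iff[OF assms] Finite_Cartesian_Product.vec_eq_iff)
    show "eta \<tau> z = 0 \<longleftrightarrow> (\<exists>k. gauss_map \<tau> x \<in> chart_domain k \<and>
        \<not> bij_betw (gauss_differential \<tau> k z) (theta_tangent \<tau> x) (chart_tangent k))"
      unfolding xz gauss_map_in_chart_domain_iff[OF assms zs]
      using gauss_differential_bij_iff[OF assms zs] k by blast
  qed
  have "eta_zero_locus \<tau> \<inter> theta_smooth \<tau> = {x \<in> theta_smooth \<tau>. \<exists>z\<in>x. eta \<tau> z = 0}"
    by (auto simp: eta_zero_locus_def theta_smooth_def)
  also have "\<dots> = gauss_ramification_locus \<tau>"
    unfolding gauss_ramification_locus_def by (intro Collect_cong conj_cong refl pointwise)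
  finally show ?thesis .
qed

end
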